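(* Let $n>1$ be an odd integer, let $r\geqslant 1$, and let $d\in\{1,2\}$. Then, modulo \[ [n^r]\prod_{j=0}^{(n^{r-1}-1)/d}(1-aq^{(2j+1)n})(a-q^{(2j+1)n}), \] we have \[ \sum_{k=0}^{(n^r-1)/d}[4k+1]\frac{(aq;q^2)_k (q/a;q^2)_k(q;q^2)_k^2} {(aq^2;q^2)_k (q^2/a;q^2)_k(q^2;q^2)_k^2} \equiv q^{(1-n)/2} [n] \sum_{k=0}^{(n^{r-1}-1)/d}[4k+1]_{q^n} \frac{(aq^n;q^{2n})_k (q^n/a;q^{2n})_k(q^{n};q^{2n})_k^2} {(aq^{2n};q^{2n})_k (q^{2n}/a;q^{2n})_k(q^{2n};q^{2n})_k^2}. \]
   Context: Here $a$ is an indeterminate and both sides are rational functions in $q$ and $a$. Notation: $(x;q)_k=(1-x)(1-xq)\cdots(1-xq^{k-1})$ (with $(x;q)_0=1$) is the $q$-shifted factorial; $[m]=[m]_q=1+q+\cdots+q^{m-1}$ is the $q$-integer, and $[m]_{q^n}=1+q^n+\cdots+q^{n(m-1)}$. For rational functions $A,B$ in $q,a$ and a polynomial $P$ in $q,a$, $A\equiv B\pmod{P}$ means that $A-B$ can be written as a quotient of polynomials whose numerator is divisible by $P$ and whose denominator is relatively prime to $P$. *)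

theory Defs
  imports "HOL-Computational_Algebra.Computational_Algebra"
begin

text \<open>Bivariate polynomials in q and a with integer coefficients: int poly poly,
  outer variable a, inner (coefficient) variable q.  Rational functions in q, a:
  the fraction field (int poly poly) fract.\<close>

type_synonym bipoly = "int poly poly"
type_synonym ratfun = "bipoly fract"

definition var_a :: bipoly where "var_a = [:0, 1:]"
definition var_q :: bipoly where "var_q = [:[:0, 1:]:]"

definition qa :: ratfun where "qa = to_fract var_a"
definition qq :: ratfun where "qq = to_fract var_q"

definition qpoch :: "'a::comm_ring_1 \<Rightarrow> 'a \<Rightarrow> nat \<Rightarrow> 'a" where
  "qpoch x p k = (\<Prod>i<k. 1 - x * p ^ i)"

definition qint :: "'a::comm_ring_1 \<Rightarrow> nat \<Rightarrow> 'a" where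
  "qint p m = (\<Sum>i<m. p ^ i)"

definition cong_rf :: "ratfun \<Rightarrow> ratfun \<Rightarrow> bipoly \<Rightarrow> bool" where
  "cong_rf A B P \<longleftrightarrow> (\<exists>N D. D \<noteq> 0 \<and> coprime D P \<and> P dvd N \<and>
      A - B = to_fract N / to_fract D)"

end

(* At a = q^N or a = q^(-N) with N = (2 j + 1) n, both sums terminate and are instances
   of the very-well-poised 6phi5 summation, with common value q^((1 - N) / 2) [N]; this gives
   divisibility by the factors 1 - a q^N and a - q^N. At a root of unity z of odd order m > 1 the
   summand, once the common zeros of (q;q^2)_k and (q^2;q^2)_k are cancelled, is multiplicative
   over blocks of length m, vanishes in the second half of a block, and is antisymmetric under
   k -> (m - 1) / 2 - k in the first half; hence the left sum vanishes there, and on the right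
   either the factor [n] or the sum does. Both facts are checked at complex points: a polynomial
   over the integers is divisible by [n^r] if it vanishes at all nontrivial n^r-th roots of unity, and
   by a linear factor in a if it vanishes at infinitely many points of the corresponding curve. *)
theory Submission
  imports Defs
begin

text \<open>The obstacle is that (q^2;q^2)_k shares factors with [n^r]: termwise there is neither a
  denominator prime to the modulus nor a value at a root of unity. The identity (q;q^2)_k /
  (q^2;q^2)_k = G_k / (-q;q)_k^2, with G_k the central Gaussian binomial coefficient, repairs both.
  The denominators left are made of 1 + q^i, 1 - a q^(2 i) and a - q^(2 i), which are prime to the
  modulus because n is odd; so the difference of the two sides has an admissible denominator, and
  only its numerator remains to be studied. The terminating summation is proved by a recurrence
  under a -> a q^2 that starts at a = q, where one term survives. Only the points a = q^N need it,
  since both sides are symmetric in a and 1/a. The sample points have to avoid all denominators. The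
  integers from 2 on serve twice: as values of q when a = q^N or a = q^(-N), since they are not
  roots of unity, and as values of a when q is a root of unity, since then every power of q has
  modulus 1.\<close>

definition vwp_term :: "'a::field \<Rightarrow> 'a \<Rightarrow> nat \<Rightarrow> 'a" where
  "vwp_term a q k = qint q (4 * k + 1) *
     (qpoch (a * q) (q ^ 2) k * qpoch (q / a) (q ^ 2) k * (qpoch q (q ^ 2) k) ^ 2) /
     (qpoch (a * q ^ 2) (q ^ 2) k * qpoch (q ^ 2 / a) (q ^ 2) k * (qpoch (q ^ 2) (q ^ 2) k) ^ 2)"

section \<open>Elementary identities for q-shifted factorials and q-integers\<close>

lemma qpoch_0 [simp]: "qpoch x p 0 = 1"
  by (simp add: qpoch_def)

lemma qpoch_Suc: "qpoch x p (Suc k) = qpoch x p k * (1 - x * p ^ k)"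
  by (simp add: qpoch_def)

lemma qpoch_Suc_left: "qpoch x p (Suc k) = (1 - x) * qpoch (x * p) p k"
  unfolding qpoch_def by (subst prod.lessThan_Suc_shift) (simp add: mult.assoc)

lemma qpoch_add: "qpoch x p (k + l) = qpoch x p k * qpoch (x * p ^ k) p l"
  by (induction l) (simp_all add: qpoch_Suc power_add mult_ac)

lemma qpoch_eq_0_iff: "qpoch x p k = 0 \<longleftrightarrow> (\<exists>i<k. x * p ^ i = (1::'a::field))"
  unfolding qpoch_def by (auto simp: prod_zero_iff)

lemma qint_mult: "(1 - p) * qint p m = 1 - p ^ m"
  unfolding qint_def using one_diff_power_eq[of p m] by simp

lemma qint_eq: "p \<noteq> (1::'a::field) \<Longrightarrow> qint p m = (1 - p ^ m) / (1 - p)"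
  using qint_mult[of p m] by (simp add: field_simps)

section \<open>Gaussian binomials and the regularised summand\<close>

text \<open>The Gaussian binomial coefficient [k + l choose k], indexed by the two parts. The
  q-Pascal recursion involves no division, so it makes sense at every q and is compatible with
  evaluation and localisation by a plain induction.\<close>

fun qbinom :: "'a::comm_ring_1 \<Rightarrow> nat \<Rightarrow> nat \<Rightarrow> 'a" where
  "qbinom q 0 l = 1"
| "qbinom q (Suc k) 0 = 1"
| "qbinom q (Suc k) (Suc l) = qbinom q k (Suc l) + q ^ Suc k * qbinom q (Suc k) l"

lemma qbinom_0_right [simp]: "qbinom q k 0 = 1"
  by (cases k) auto

text \<open>Both sides equal (1 - q^(k + l + 1)) \<open>qbinom q k l\<close>. Expanding them by the
  recursion needs the claim at (k, l - 1) and at (k - 1, l), hence the induction on k + l. The form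
  without division survives where 1 - q^i vanishes.\<close>

lemma qbinom_swap_step:
  "(1 - q ^ Suc k) * qbinom q (Suc k) l = (1 - q ^ Suc l) * qbinom q k (Suc l)"
proof (induction "k + l" arbitrary: k l rule: less_induct)
  case less
  have "(1 - q ^ Suc k) * qbinom q (Suc k) l = (1 - q ^ Suc (k + l)) * qbinom q k l"
  proof (cases l)
    case (Suc l')
    have "(1 - q ^ Suc k) * qbinom q (Suc k) (Suc l')
        = (1 - q ^ Suc k) * qbinom q k (Suc l') + q ^ Suc k * ((1 - q ^ Suc k) * qbinom q (Suc k) l')"
      by (simp add: algebra_simps)
    also have "\<dots> = (1 - q ^ Suc k) * qbinom q k (Suc l') + q ^ Suc k * ((1 - q ^ Suc l') * qbinom q k (Suc l'))"
      using less[of k l'] Suc by simp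
    also have "\<dots> = (1 - q ^ Suc (k + Suc l')) * qbinom q k (Suc l')"
      by (simp add: algebra_simps power_add)
    finally show ?thesis using Suc by simp
  qed simp
  moreover have "(1 - q ^ Suc l) * qbinom q k (Suc l) = (1 - q ^ Suc (k + l)) * qbinom q k l"
  proof (cases k)
    case (Suc k')
    have "(1 - q ^ Suc l) * qbinom q (Suc k') (Suc l)
        = (1 - q ^ Suc l) * qbinom q k' (Suc l) + (1 - q ^ Suc l) * q ^ Suc k' * qbinom q (Suc k') l"
      by (simp add: algebra_simps)
    also have "\<dots> = (1 - q ^ Suc k') * qbinom q (Suc k') l + (1 - q ^ Suc l) * q ^ Suc k' * qbinom q (Suc k') l"
      using less[of k' l] Suc by simp
    also have "\<dots> = (1 - q ^ Suc (Suc k' + l)) * qbinom q (Suc k') l"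
      by (simp add: algebra_simps power_add)
    finally show ?thesis using Suc by simp
  qed simp
  ultimately show ?case by simp
qed

lemma qbinom_Suc_left:
  "(1 - q ^ Suc k) * qbinom q (Suc k) l = (1 - q ^ Suc (k + l)) * qbinom q k l"
proof (cases l)
  case (Suc l')
  have "(1 - q ^ Suc k) * qbinom q (Suc k) (Suc l')
      = (1 - q ^ Suc k) * qbinom q k (Suc l') + q ^ Suc k * ((1 - q ^ Suc k) * qbinom q (Suc k) l')"
    by (simp add: algebra_simps)
  also have "\<dots> = (1 - q ^ Suc (k + Suc l')) * qbinom q k (Suc l')"
    unfolding qbinom_swap_step by (simp add: algebra_simps power_add)
  finally show ?thesis using Suc by simp
qed simp

lemma qbinom_central_Suc:
  "(1 - q ^ Suc k) ^ 2 * qbinom q (Suc k) (Suc k)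
     = (1 - q ^ (2 * k + 1)) * (1 - q ^ (2 * k + 2)) * qbinom q k k"
proof -
  have "(1 - q ^ Suc k) ^ 2 * qbinom q (Suc k) (Suc k)
      = (1 - q ^ Suc (k + Suc k)) * ((1 - q ^ Suc k) * qbinom q k (Suc k))"
    unfolding power2_eq_square mult.assoc qbinom_Suc_left by (simp add: mult_ac)
  also have "\<dots> = (1 - q ^ Suc (k + Suc k)) * ((1 - q ^ Suc (k + k)) * qbinom q k k)"
    unfolding qbinom_swap_step[symmetric] qbinom_Suc_left ..
  finally show ?thesis by (simp add: mult_2 mult_2_right mult_ac)
qed

text \<open>This is \<open>(q;q\<^sup>2)\<^sub>k / (q\<^sup>2;q\<^sup>2)\<^sub>k\<close> with the zeros at odd-order roots of unity
  cancelled, so that it can be evaluated there.\<close>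

definition central_ratio :: "'a::field \<Rightarrow> nat \<Rightarrow> 'a" where
  "central_ratio q k = qbinom q k k / qpoch (- q) q k ^ 2"

lemma central_ratio_0 [simp]: "central_ratio q 0 = 1"
  by (simp add: central_ratio_def)

text \<open>Only the denominator of the new factor has to be nonzero. Earlier ones may vanish, so
  the recursion stays usable beyond the first block at a root of unity.\<close>

lemma central_ratio_Suc:
  assumes "q ^ (2 * k + 2) \<noteq> 1"
  shows "central_ratio q (Suc k) = central_ratio q k * ((1 - q ^ (2 * k + 1)) / (1 - q ^ (2 * k + 2)))"
proof -
  define y where "y = q ^ Suc k"
  have y2: "q ^ (2 * k + 2) = y ^ 2"
    unfolding y_def power_mult[symmetric] by (simp add: mult.commute)
  have ny: "1 - y \<noteq> 0" "1 + y \<noteq> 0" "1 - y ^ 2 \<noteq> 0"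
    using assms unfolding y2 by (auto simp: add_eq_0_iff)
  have fac: "1 - y ^ 2 = (1 - y) * (1 + y)"
    by (simp add: algebra_simps power2_eq_square)
  have 1: "(1 - y) ^ 2 * qbinom q (Suc k) (Suc k)
     = (1 - q ^ (2 * k + 1)) * (1 - y ^ 2) * qbinom q k k"
    using qbinom_central_Suc[of q k] unfolding y2 y_def by simp
  \<comment> \<open>One factor 1 + y is gained here, while (-q;q)_k^2 puts (1 + y)^2 below; together
    they leave (1 - y) (1 + y) = 1 - q^(2 k + 2) in the denominator.\<close>
  have 2: "qbinom q (Suc k) (Suc k) = (1 - q ^ (2 * k + 1)) * (1 + y) * qbinom q k k / (1 - y)"
  proof -
    have "X = Z * (1 + y) * B / (1 - y)" if "(1 - y) ^ 2 * X = Z * ((1 - y) * (1 + y)) * B" for X Z B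
    proof -
      have "(1 - y) * ((1 - y) * X) = (1 - y) * (Z * (1 + y) * B)"
        using that by (simp add: power2_eq_square mult_ac)
      then have "(1 - y) * X = Z * (1 + y) * B" using ny(1) by (metis mult_cancel_left)
      then show ?thesis using ny(1) by (simp add: eq_divide_eq mult_ac)
    qed
    then show ?thesis using 1 unfolding fac by blast
  qed
  have 3: "qpoch (- q) q (Suc k) = qpoch (- q) q k * (1 + y)"
    by (simp add: qpoch_Suc y_def)
  have gen: "X * (1 + y) * B / (1 - y) / (Q * (1 + y)) ^ 2 = B / Q ^ 2 * (X / ((1 - y) * (1 + y)))" for X B Q :: 'a
  proof -
    have "X * v * B / u / (Q * v) ^ 2 = B / Q ^ 2 * (X / (u * v))" if "v \<noteq> 0" for u v :: 'a
      using that by (simp add: divide_inverse power2_eq_square mult_ac)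
    then show ?thesis using ny(2) .
  qed
  show ?thesis
    unfolding central_ratio_def 3 2 y2 fac by (rule gen)
qed

lemma central_ratio_eq:
  assumes "\<And>i. 0 < i \<Longrightarrow> i \<le> k \<Longrightarrow> q ^ (2 * i) \<noteq> 1"
  shows "central_ratio q k = qpoch q (q ^ 2) k / qpoch (q ^ 2) (q ^ 2) k"
  using assms
proof (induction k)
  case (Suc k)
  have "q ^ (2 * k + 2) \<noteq> 1" using Suc.prems[of "Suc k"] by simp
  then have "central_ratio q (Suc k) = central_ratio q k * ((1 - q ^ (2 * k + 1)) / (1 - q ^ (2 * k + 2)))"
    by (rule central_ratio_Suc)
  moreover have "central_ratio q k = qpoch q (q ^ 2) k / qpoch (q ^ 2) (q ^ 2) k"
    using Suc by simp
  ultimately show ?case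
    by (simp add: qpoch_Suc flip: power_mult power_add power_Suc)
qed simp

text \<open>Up to powers of a, the denominators are products of 1 + q^i, 1 - a q^(2 i) and a - q^(2
  i) with i > 0.\<close>

definition reg_term :: "'a::field \<Rightarrow> 'a \<Rightarrow> nat \<Rightarrow> 'a" where
  "reg_term a q k = qint q (4 * k + 1) *
     (qpoch (a * q) (q ^ 2) k * qpoch (q / a) (q ^ 2) k * central_ratio q k ^ 2) /
     (qpoch (a * q ^ 2) (q ^ 2) k * qpoch (q ^ 2 / a) (q ^ 2) k)"

lemma reg_term_eq:
  assumes "\<And>i. 0 < i \<Longrightarrow> i \<le> k \<Longrightarrow> q ^ (2 * i) \<noteq> 1"
  shows "reg_term a q k = vwp_term a q k"
proof -
  have "central_ratio q k = qpoch q (q ^ 2) k / qpoch (q ^ 2) (q ^ 2) k"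
    using assms by (rule central_ratio_eq)
  then show ?thesis
    by (simp add: reg_term_def vwp_term_def power_divide mult.assoc)
qed

section \<open>The terminating sum\<close>

text \<open>The two summands, combined as on the left, telescope in \<open>k\<close>; the right-hand side is the
  resulting certificate. Its factor \<open>qpoch (q / a) (q\<^sup>2) K\<close> vanishes in the terminating case.\<close>

lemma vwp_sum_shift:
  fixes a q :: "'a::field"
  assumes a0: "a \<noteq> 0" and q0: "q \<noteq> 0" and q1: "\<And>i. 0 < i \<Longrightarrow> q ^ i \<noteq> 1"
    and aq: "a * q \<noteq> 1" and aq2: "\<And>i. a * q ^ (2 * i) \<noteq> 1" and qa: "\<And>i. q ^ (2 * i) \<noteq> a"
  shows "(1 - a) * q * (\<Sum>k\<le>K. vwp_term (a * q ^ 2) q k) - (1 - a * q ^ 2) * (\<Sum>k\<le>K. vwp_term a q k)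
    = - ((1 - a * q ^ 2) * (1 + a * q) / ((1 - q) * (1 - a * q))) *
      ((1 - q ^ (2 * K + 2)) ^ 2 * (1 - q ^ (2 * K + 2) / a) *
       qpoch (a * q) (q ^ 2) (Suc K) * qpoch (q / a) (q ^ 2) K * qpoch q (q ^ 2) (Suc K) ^ 2 /
      (qpoch (a * q ^ 2) (q ^ 2) (Suc K) * qpoch (q ^ 2 / a) (q ^ 2) (Suc K) * qpoch (q ^ 2) (q ^ 2) (Suc K) ^ 2))"
  (is "_ = ?G K")
proof (induction K)
  case 0
  have "q \<noteq> 1" "q ^ 2 \<noteq> 1" "a * q ^ 2 \<noteq> 1" "1 - q ^ 2 / a \<noteq> 0"
    using q1[of 1] q1[of 2] aq2[of 1] qa[of 1] a0 by auto
  then have "?G 0 = - ((1 + a * q) * (1 - q))"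
    using aq by (simp add: qpoch_Suc power2_eq_square)
  then show ?case
    by (simp add: vwp_term_def qint_def algebra_simps power2_eq_square)
next
  case (Suc K)
  \<comment> \<open>With q^(2 K + 2) abstracted to y, the induction step becomes a rational identity
    in a, q and y.\<close>
  define y where "y = q ^ (2 * K + 2)"
  have yK: "(q ^ 2) ^ Suc K = y" "q ^ (2 * Suc K + 2) = y * q ^ 2" "q ^ (2 * Suc K) = y"
    "q ^ (4 * Suc K + 1) = q * y ^ 2"
    unfolding y_def by (simp_all add: power_mult[symmetric] power_add[symmetric] power_Suc[symmetric]
        mult_ac add_ac eval_nat_numeral del: power_Suc)
  have yK': "q * (q ^ 2) ^ K = y / q"
    using q0 unfolding y_def by (simp add: power_add power2_eq_square power_mult)
  define A B C D E F where "A = qpoch (a * q) (q ^ 2) (Suc K)" and "B = qpoch (q / a) (q ^ 2) K"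
    and "C = qpoch q (q ^ 2) (Suc K)" and "D = qpoch (a * q ^ 2) (q ^ 2) (Suc K)"
    and "E = qpoch (q ^ 2 / a) (q ^ 2) (Suc K)" and "F = qpoch (q ^ 2) (q ^ 2) (Suc K)"
  \<comment> \<open>Both summands at \<open>Suc K\<close> and both certificates are rational
    functions of a, q, y times this common factor.\<close>
  define U where "U = A * B * C ^ 2 / (D * E * F ^ 2)"
  have ne: "1 - q \<noteq> 0" "1 - y * q ^ 2 \<noteq> 0" "1 - a * q ^ 2 * y \<noteq> 0" "1 - y * q ^ 2 / a \<noteq> 0" "1 - y / a \<noteq> 0"
     "1 - a * q \<noteq> 0" "1 - a * q ^ 2 \<noteq> 0" "1 - a \<noteq> 0"
    using q1[of 1] q1[of "2 * Suc K + 2"] aq2[of "Suc (Suc K)"] aq2[of 1] aq2[of 0]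
      qa[of "Suc (Suc K)"] qa[of "Suc K"] a0 aq
    by (auto simp: y_def power_add power_mult power2_eq_square mult_ac)
  have Ck: "qint q (4 * Suc K + 1) = (1 - q * y ^ 2) / (1 - q)"
    using ne(1) by (subst qint_eq) (simp_all only: yK, auto)
  have ta: "vwp_term a q (Suc K) = (1 - q * y ^ 2) / (1 - q) * (1 - y / (q * a)) * U"
  proof -
    have "qpoch (q / a) (q ^ 2) (Suc K) = B * (1 - y / (q * a))"
      unfolding qpoch_Suc B_def using yK' by simp
    then show ?thesis
      unfolding vwp_term_def Ck A_def[symmetric] C_def[symmetric] D_def[symmetric] E_def[symmetric] F_def[symmetric]
      by (simp add: U_def)
  qed
  have tq: "(1 - a) * q * vwp_term (a * q ^ 2) q (Suc K)
      = (1 - a * q ^ 2) * ((1 - q * y ^ 2) / (1 - q) * ((1 - a * q * y) * (1 - y / a) / (1 - a * q ^ 2 * y))) * U"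
  proof -
    have 1: "qpoch (a * q ^ 2 * q) (q ^ 2) (Suc K) = A * (1 - a * q * y) / (1 - a * q)"
      using qpoch_Suc_left[of "a * q" "q ^ 2" "Suc K"] qpoch_Suc[of "a * q" "q ^ 2" "Suc K"] ne
      unfolding A_def[symmetric] yK by (simp add: field_simps)
    have 2: "qpoch (q / (a * q ^ 2)) (q ^ 2) (Suc K) = (1 - 1 / (a * q)) * B"
      unfolding qpoch_Suc_left B_def using q0 by (simp add: power2_eq_square)
    have 3: "qpoch (a * q ^ 2 * q ^ 2) (q ^ 2) (Suc K) = D * (1 - a * q ^ 2 * y) / (1 - a * q ^ 2)"
      using qpoch_Suc_left[of "a * q ^ 2" "q ^ 2" "Suc K"] qpoch_Suc[of "a * q ^ 2" "q ^ 2" "Suc K"] ne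
      unfolding D_def[symmetric] yK by (simp add: field_simps)
    have 4: "qpoch (q ^ 2 / (a * q ^ 2)) (q ^ 2) (Suc K) = (1 - 1 / a) * E / (1 - y / a)"
    proof -
      have "qpoch (1 / a) (q ^ 2) (Suc K) * (1 - y / a) = (1 - 1 / a) * E"
        using qpoch_Suc_left[of "1 / a" "q ^ 2" "Suc K"] qpoch_Suc[of "1 / a" "q ^ 2" "Suc K"]
        unfolding E_def yK by simp
      then have "qpoch (1 / a) (q ^ 2) (Suc K) = (1 - 1 / a) * E / (1 - y / a)"
        using ne(5) by (simp add: nonzero_eq_divide_eq)
      moreover have "q ^ 2 / (a * q ^ 2) = 1 / a" using q0 by simp
      ultimately show ?thesis by simp
    qed
    have 5: "(1 - a) * q * (X * (A * (1 - a * q * y) / (1 - a * q) * ((1 - 1 / (a * q)) * B) * C2)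
      / (D * (1 - a * q ^ 2 * y) / (1 - a * q ^ 2) * ((1 - 1 / a) * E / (1 - y / a)) * F2))
      = (1 - a * q ^ 2) * (X * ((1 - a * q * y) * (1 - y / a) / (1 - a * q ^ 2 * y))) * (A * B * C2 / (D * E * F2))"
      for X C2 F2
    proof -
      \<comment> \<open>This relation explains the weights (1 - a) q and 1 - a q^2 of the two sums:
        they absorb the boundary factors created by the shift a -> a q^2.\<close>
      have e: "(1 - a) * q * (1 - 1 / (a * q)) = (1 - a * q) * (1 - 1 / a)"
        using a0 q0 by (simp add: field_simps)
      have g: "(1 - a) * q * (X * (A * u / m * (r * B) * C2) / (D * v / n * (s * E / w) * F2))
         = n * (X * (u * w / v)) * (A * B * C2 / (D * E * F2))"
         if "(1 - a) * q * r = m * s" "m \<noteq> 0" "s \<noteq> 0" for u v w m n r s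
      proof -
        have *: "(1 - a) * q * (X * (A * u / m * (r * B) * C2) / (D * v / n * (s * E / w) * F2))
          = ((1 - a) * q * r) * (X * (A * u / m * B * C2) / (D * v / n * (s * E / w) * F2))"
          by (simp add: mult_ac)
        show ?thesis unfolding * that(1) using that(2,3) by (simp add: divide_simps)
      qed
      show ?thesis
        using ne(8) a0 by (intro g e ne(6)) auto
    qed
    show ?thesis
      unfolding vwp_term_def Ck 1 2 3 4 C_def[symmetric] F_def[symmetric] U_def by (rule 5)
  qed
  define c where "c = - ((1 - a * q ^ 2) * (1 + a * q) / ((1 - q) * (1 - a * q)))"
  have G: "?G K = c * ((1 - y) ^ 2 * (1 - y / a)) * U"
    unfolding c_def U_def A_def B_def C_def D_def E_def F_def y_def by simp
  have GS: "?G (Suc K) = c * ((1 - a * q * y) * (1 - y / (q * a)) * (1 - q * y) ^ 2 / (1 - a * q ^ 2 * y)) * U"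
  proof -
    have *: "c * (y2 ^ 2 * w * (A * u) * (B * v) * (C * s) ^ 2 / (D * t * (E * w) * (F * y2) ^ 2))
      = c * (u * v * s ^ 2 / t) * U" if "y2 \<noteq> 0" "w \<noteq> 0" for y2 w u v s t
      using that unfolding U_def by (simp add: power_mult_distrib mult_ac)
    have 1: "qpoch (q / a) (q ^ 2) (Suc K) = B * (1 - y / (q * a))"
      unfolding qpoch_Suc B_def using yK' by simp
    show ?thesis
      unfolding qpoch_Suc[of _ _ "Suc K"] 1 yK c_def[symmetric]
        A_def[symmetric] C_def[symmetric] D_def[symmetric] E_def[symmetric] F_def[symmetric]
      using *[OF ne(2,4), of "1 - a * q * y" "1 - y / (q * a)" "1 - q * y" "1 - a * q ^ 2 * y"]
      by (simp add: mult_ac)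
  qed
  have id: "(1 - a * q ^ 2) * ((1 - q * y ^ 2) / (1 - q) * ((1 - a * q * y) * (1 - y / a) / (1 - a * q ^ 2 * y)))
    - (1 - a * q ^ 2) * ((1 - q * y ^ 2) / (1 - q) * (1 - y / (q * a)))
    = c * ((1 - a * q * y) * (1 - y / (q * a)) * (1 - q * y) ^ 2 / (1 - a * q ^ 2 * y))
    - c * ((1 - y) ^ 2 * (1 - y / a))"
  proof -
    have core: "(1 - q * y ^ 2) * (1 - a * q) * ((1 - a * q * y) * (1 - y / a) - (1 - y / (q * a)) * (1 - a * q ^ 2 * y))
      = - (1 + a * q) * ((1 - a * q * y) * (1 - y / (q * a)) * (1 - q * y) ^ 2
          - (1 - y) ^ 2 * (1 - y / a) * (1 - a * q ^ 2 * y))"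
    proof -
      \<comment> \<open>With b = 1/a and p = 1/q the claim is a polynomial identity modulo a b = 1
        and q p = 1.\<close>
      define b p where "b = inverse a" and "p = inverse q"
      have "a * b = 1" "q * p = 1" using a0 q0 by (simp_all add: b_def p_def)
      then have "(1 - q * y ^ 2) * (1 - a * q) * ((1 - a * q * y) * (1 - y * b) - (1 - y * p * b) * (1 - a * q ^ 2 * y))
      = - (1 + a * q) * ((1 - a * q * y) * (1 - y * p * b) * (1 - q * y) ^ 2
          - (1 - y) ^ 2 * (1 - y * b) * (1 - a * q ^ 2 * y))"
        by algebra
      then show ?thesis by (simp add: b_def p_def divide_inverse mult_ac)
    qed
    have g: "n * (X / m * (uw / v)) - n * (X / m * z) = - (n * e / (m * l)) * (f / v) - - (n * e / (m * l)) * g"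
      if "X * l * (uw - z * v) = - e * (f - g * v)" "m \<noteq> 0" "l \<noteq> 0" "v \<noteq> 0" for n X m uw v z e l f g :: 'a
    proof -
      have "n * (X / m * (uw / v)) - n * (X / m * z) = n / (m * l * v) * (X * l * (uw - z * v))"
        using that(2-) by (simp add: field_simps)
      also have "\<dots> = n / (m * l * v) * (- e * (f - g * v))"
        by (simp only: that(1))
      also have "\<dots> = - (n * e / (m * l)) * (f / v) - - (n * e / (m * l)) * g"
        using that(2-) by (simp add: field_simps)
      finally show ?thesis .
    qed
    show ?thesis
      unfolding c_def by (rule g) (use core ne in auto)
  qed
  have "(1 - a) * q * vwp_term (a * q ^ 2) q (Suc K) - (1 - a * q ^ 2) * vwp_term a q (Suc K)
      = ?G (Suc K) - ?G K"
    unfolding tq ta G GS using arg_cong[OF id, of "\<lambda>x. x * U"] by (simp only: algebra_simps)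
  then show ?case
    using Suc.IH by (simp add: algebra_simps)
qed

lemma power_inj_nonroot:
  fixes q :: "'a::field"
  assumes "q \<noteq> 0" and "\<And>i. 0 < i \<Longrightarrow> q ^ i \<noteq> 1" and "q ^ i = q ^ j"
  shows "i = j"
proof -
  have aux: "i = j" if "i \<le> j" "q ^ i = q ^ j" for i j :: nat
  proof -
    have "q ^ i * q ^ (j - i) = q ^ i * 1"
      using that by (metis le_add_diff_inverse mult.right_neutral power_add)
    then have "q ^ (j - i) = 1" using assms(1) by simp
    then have "\<not> 0 < j - i" using assms(2) by blast
    then show ?thesis using that by simp
  qed
  show ?thesis using aux[of i j] aux[of j i] assms(3) by (cases "i \<le> j") auto
qed

lemma qpoch_terminating:
  fixes q :: "'a::field"
  assumes "q \<noteq> 0" and "m < k"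
  shows "qpoch (q / q ^ (2 * m + 1)) (q ^ 2) k = 0"
  unfolding qpoch_eq_0_iff using assms
  by (intro exI[of _ m]) (simp add: power_mult power_add)

text \<open>When the certificate vanishes, \<open>vwp_sum_shift\<close> is a first-order recurrence:
  passing from a = q^(2 m + 1) to a q^2 multiplies the sum by (1 - a q^2) / ((1 - a) q). At a = q
  only the term k = 0 is nonzero.\<close>

lemma vwp_sum_terminating:
  fixes q :: "'a::field"
  assumes q0: "q \<noteq> 0" and q1: "\<And>i. 0 < i \<Longrightarrow> q ^ i \<noteq> 1" and "m \<le> K"
  shows "(\<Sum>k\<le>K. vwp_term (q ^ (2 * m + 1)) q k) = (1 - q ^ (2 * m + 1)) / (1 - q) / q ^ m"
  using \<open>m \<le> K\<close>
proof (induction m)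
  case 0
  have "(\<Sum>k\<le>K. vwp_term q q k) = (\<Sum>k\<in>{0}. vwp_term q q k)"
  proof (rule sum.mono_neutral_right)
    show "\<forall>k\<in>{..K} - {0}. vwp_term q q k = 0"
      using qpoch_terminating[OF q0, of 0] by (auto simp: vwp_term_def)
  qed auto
  then show ?case using q1[of 1] by (simp add: vwp_term_def qint_def)
next
  case (Suc m)
  define a where "a = q ^ (2 * m + 1)"
  have aS: "q ^ (2 * Suc m + 1) = a * q ^ 2"
    unfolding a_def by (simp flip: power_add)
  have IH: "(\<Sum>k\<le>K. vwp_term a q k) = (1 - a) / (1 - q) / q ^ m"
    unfolding a_def using Suc by simp
  \<comment> \<open>The certificate contains (q/a;q^2) only up to length K, not K + 1, so m < K is
    needed; this is what \<open>Suc m\<close> below or equal to K provides.\<close>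
  have "qpoch (q / a) (q ^ 2) K = 0"
    unfolding a_def using q0 Suc.prems by (intro qpoch_terminating) auto
  moreover have "a \<noteq> 0" using q0 by (simp add: a_def)
  moreover have "a * q \<noteq> 1" "a * q ^ (2 * i) \<noteq> 1" for i
    using q1[of "2 * m + 1 + 1"] q1[of "2 * m + 1 + 2 * i"] unfolding a_def
    by (simp_all only: power_add power_one_right not_False_eq_True add_gr_0 zero_less_one simp_thms)
  moreover have "q ^ (2 * i) \<noteq> a" for i
  proof
    assume "q ^ (2 * i) = a"
    then have "q ^ (2 * i) = q ^ (2 * m + 1)" by (simp only: a_def)
    then have "2 * i = 2 * m + 1"
      by (rule power_inj_nonroot[of q, rotated 2]) (use q0 q1 in blast)+
    then show False by presburger
  qed
  ultimately have "(1 - a) * q * (\<Sum>k\<le>K. vwp_term (a * q ^ 2) q k) = (1 - a * q ^ 2) * (\<Sum>k\<le>K. vwp_term a q k)"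
    using vwp_sum_shift[of a q K] q0 q1 by simp
  then have "(1 - a) * (q * (\<Sum>k\<le>K. vwp_term (a * q ^ 2) q k)) = (1 - a) * ((1 - a * q ^ 2) / (1 - q) / q ^ m)"
    unfolding IH by (simp add: mult_ac)
  moreover have "1 - a \<noteq> 0" using q1[of "2 * m + 1"] by (auto simp: a_def)
  ultimately have "q * (\<Sum>k\<le>K. vwp_term (a * q ^ 2) q k) = (1 - a * q ^ 2) / (1 - q) / q ^ m"
    by (metis mult_cancel_left)
  then have "(\<Sum>k\<le>K. vwp_term (a * q ^ 2) q k) = (1 - a * q ^ 2) / (1 - q) / q ^ m / q"
    using q0 by (metis nonzero_mult_div_cancel_left)
  then show ?case
    unfolding aS by (simp add: mult_ac)
qed

section \<open>The sum at roots of unity\<close>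

text \<open>The numerator factor 1 - q^(2 h + 1) enters at index h + 1, and no denominator factor
  vanishes before index 2 h + 1.\<close>

lemma central_ratio_eq_0:
  assumes "\<And>i. 0 < i \<Longrightarrow> i < 2 * h + 1 \<Longrightarrow> q ^ (2 * i) \<noteq> 1"
    and "q ^ (2 * h + 1) = 1" and "h < k" and "k < 2 * h + 1"
  shows "central_ratio q k = 0"
  using \<open>h < k\<close> \<open>k < 2 * h + 1\<close>
proof (induction k)
  case (Suc k)
  have "q ^ (2 * k + 2) \<noteq> 1" using assms(1)[of "Suc k"] Suc.prems by simp
  then have *: "central_ratio q (Suc k) = central_ratio q k * ((1 - q ^ (2 * k + 1)) / (1 - q ^ (2 * k + 2)))"
    by (rule central_ratio_Suc)
  show ?case
  proof (cases "k = h")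
    case True
    then show ?thesis unfolding * using assms(2) by simp
  next
    case False
    then show ?thesis unfolding * using Suc by simp
  qed
qed simp

text \<open>The step quotients are periodic in the index with period m. Only steps inside a block
  are used, so the index l m, where the denominator of the quotient vanishes, is never crossed and
  the value at the block start stays unevaluated.\<close>

lemma central_ratio_block:
  assumes "\<And>i. 0 < i \<Longrightarrow> i < m \<Longrightarrow> q ^ (2 * i) \<noteq> 1" and "q ^ m = 1" and "j < m"
  shows "central_ratio q (l * m + j) = central_ratio q (l * m) * central_ratio q j"
  using \<open>j < m\<close>
proof (induction j)
  case (Suc j)
  have per: "q ^ (2 * (l * m + j) + i) = q ^ (2 * j + i)" for i
  proof -
    have "q ^ (2 * (l * m + j) + i) = (q ^ m) ^ (2 * l) * q ^ (2 * j + i)"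
      by (simp add: algebra_simps flip: power_mult power_add)
    then show ?thesis using assms(2) by simp
  qed
  have ne: "q ^ (2 * j + 2) \<noteq> 1" using assms(1)[of "Suc j"] Suc.prems by simp
  have "central_ratio q (Suc (l * m + j)) =
    central_ratio q (l * m + j) * ((1 - q ^ (2 * j + 1)) / (1 - q ^ (2 * j + 2)))"
    using central_ratio_Suc[of q "l * m + j"] ne unfolding per by blast
  then show ?case using Suc central_ratio_Suc[OF ne] by simp
qed simp

text \<open>As q^(2 l m) = 1, a shifted factorial of length l m + j splits into one of length l m
  and one of length j with the same argument; the q-integer at a block start is 1.\<close>

lemma reg_term_block:
  assumes "\<And>i. 0 < i \<Longrightarrow> i < m \<Longrightarrow> q ^ (2 * i) \<noteq> 1" and "q ^ m = 1" and "q \<noteq> 1" and "j < m"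
  shows "reg_term a q (l * m + j) = reg_term a q (l * m) * reg_term a q j"
proof -
  have per: "(q ^ 2) ^ (l * m) = 1"
  proof -
    have "(q ^ 2) ^ (l * m) = (q ^ m) ^ (2 * l)"
      by (simp add: mult_ac flip: power_mult)
    then show ?thesis using assms(2) by simp
  qed
  have "qint q (4 * (l * m + j) + 1) = qint q (4 * j + 1)"
  proof -
    have "q ^ (4 * (l * m + j) + 1) = ((q ^ 2) ^ (l * m)) ^ 2 * q ^ (4 * j + 1)"
      by (simp add: algebra_simps flip: power_mult power_add)
    then show ?thesis using per \<open>q \<noteq> 1\<close> by (simp add: qint_eq)
  qed
  moreover have "qint q (4 * (l * m) + 1) = 1"
  proof -
    have "q ^ (4 * (l * m) + 1) = ((q ^ 2) ^ (l * m)) ^ 2 * q"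
      by (simp add: algebra_simps flip: power_mult power_add)
    then show ?thesis using per \<open>q \<noteq> 1\<close> by (simp add: qint_eq)
  qed
  moreover have "central_ratio q (l * m + j) = central_ratio q (l * m) * central_ratio q j"
    using assms(1,2,4) by (rule central_ratio_block)
  ultimately show ?thesis
    unfolding reg_term_def qpoch_add per by (simp add: power_mult_distrib mult_ac)
qed

text \<open>For i + i' + 1 = h the exponents 2 i + 1 and 2 i' + 2 add up to 2 h + 1, so a numerator
  factor is a monomial times a denominator factor. The whole quotient at index h is therefore a
  monomial, and each further step of j contributes q / x^2.\<close>

lemma qpoch_ratio_reverse:
  fixes q x :: "'a::field"
  assumes x0: "x \<noteq> 0" and qh: "q ^ (2 * h + 1) = 1"
    and x1: "\<And>i. i < h \<Longrightarrow> x * q ^ (2 * i + 1) \<noteq> 1" and "j \<le> h"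
  shows "qpoch (x * q) (q ^ 2) (h - j) / qpoch (q ^ 2 / x) (q ^ 2) (h - j) =
    (- x) ^ h * q ^ (h ^ 2) * (q / x ^ 2) ^ j * (qpoch (x * q) (q ^ 2) j / qpoch (q ^ 2 / x) (q ^ 2) j)"
proof -
  have q0: "q \<noteq> 0" using qh by (metis power_0_left add_is_0 one_neq_zero zero_neq_one)
  have factor: "1 - x * q ^ (2 * i + 1) = - x * q ^ (2 * i + 1) * (1 - q ^ (2 * i' + 2) / x)"
    if "i + i' + 1 = h" for i i'
  proof -
    have "q ^ (2 * i + 1) * q ^ (2 * i' + 2) = 1"
    proof -
      have "(2 * i + 1) + (2 * i' + 2) = 2 * h + 1" using that by simp
      then show ?thesis using qh by (simp only: power_add[symmetric])
    qed
    then show ?thesis using x0 by (simp add: field_simps)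
  qed
  have ne: "1 - q ^ (2 * i + 2) / x \<noteq> 0" if "i < h" for i
    using factor[of "h - 1 - i" i] x1[of "h - 1 - i"] that by auto
  have s1: "1 - x * q * (q ^ 2) ^ i = 1 - x * q ^ (2 * i + 1)" for i
    by (simp add: power_mult)
  have s2: "1 - q ^ 2 / x * (q ^ 2) ^ i = 1 - q ^ (2 * i + 2) / x" for i
    by (simp add: power_mult power_add power2_eq_square)
  show ?thesis using \<open>j \<le> h\<close>
  proof (induction j)
    case 0
    have "qpoch (x * q) (q ^ 2) h = (\<Prod>i<h. - x * q ^ (2 * i + 1) * (1 - q ^ (2 * (h - Suc i) + 2) / x))"
      unfolding qpoch_def s1 by (intro prod.cong factor refl) auto
    also have "\<dots> = (\<Prod>i<h. - x * q ^ (2 * i + 1)) * qpoch (q ^ 2 / x) (q ^ 2) h"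
      unfolding prod.distrib qpoch_def s2 by (subst (2) prod.nat_diff_reindex) (rule refl)
    also have "(\<Prod>i<h. - x * q ^ (2 * i + 1)) = (- x) ^ h * q ^ (h ^ 2)"
    proof (induction h)
      case (Suc h)
      \<comment> \<open>The exponent h^2 is the sum of the first h odd numbers.\<close>
      have "q ^ (Suc h ^ 2) = q ^ (h ^ 2) * q ^ (2 * h + 1)"
        unfolding power_add[symmetric] by (rule arg_cong[of _ _ "\<lambda>e. q ^ e"]) (simp add: power2_eq_square)
      then show ?case using Suc by (simp add: mult_ac)
    qed simp
    finally have *: "qpoch (x * q) (q ^ 2) h = (- x) ^ h * q ^ (h ^ 2) * qpoch (q ^ 2 / x) (q ^ 2) h" .
    have "qpoch (q ^ 2 / x) (q ^ 2) h \<noteq> 0"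
      unfolding qpoch_def s2 prod_zero_iff[OF finite_lessThan] using ne by blast
    then show ?case unfolding diff_zero * by simp
  next
    case (Suc j)
    define i where "i = h - Suc j"
    have i: "h - j = Suc i" "h - Suc j = i" "i < h" using Suc.prems by (auto simp: i_def)
    define P where "P = (\<lambda>k. qpoch (x * q) (q ^ 2) k / qpoch (q ^ 2 / x) (q ^ 2) k)"
    have PS: "P (Suc k) = P k * ((1 - x * q ^ (2 * k + 1)) / (1 - q ^ (2 * k + 2) / x))" for k
      unfolding P_def qpoch_Suc s1 s2 by simp
    have r1: "1 - x * q ^ (2 * i + 1) = - x * q ^ (2 * i + 1) * (1 - q ^ (2 * j + 2) / x)"
      using Suc.prems by (intro factor) (simp add: i_def)
    have r2: "1 - x * q ^ (2 * j + 1) = - x * q ^ (2 * j + 1) * (1 - q ^ (2 * i + 2) / x)"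
      using Suc.prems by (intro factor) (simp add: i_def)
    define u v where "u = 1 - q ^ (2 * j + 2) / x" and "v = 1 - q ^ (2 * i + 2) / x"
    have uv: "u \<noteq> 0" "v \<noteq> 0" using ne[of j] ne[of i] i Suc.prems by (auto simp: u_def v_def)
    \<comment> \<open>Here i + j + 1 = h, so the total exponent is 2 h + 1.\<close>
    have qq: "q * (q ^ (2 * i + 1) * q ^ (2 * j + 1)) = 1"
    proof -
      have "q * (q ^ (2 * i + 1) * q ^ (2 * j + 1)) = q ^ (2 * h + 1)"
        unfolding power_add[symmetric] power_Suc[symmetric]
        by (rule arg_cong[of _ _ "power q"]) (use Suc.prems in \<open>simp add: i_def\<close>)
      then show ?thesis by (simp only: qh)
    qed
    have IH: "P (Suc i) = (- x) ^ h * q ^ (h ^ 2) * (q / x ^ 2) ^ j * P j"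
      using Suc i unfolding P_def by simp
    have "P i = P (Suc i) * (v / (- x * q ^ (2 * i + 1) * u))"
      unfolding PS r1 u_def[symmetric] v_def[symmetric] using uv x0 q0 by simp
    also have "v / (- x * q ^ (2 * i + 1) * u) = q / x ^ 2 * ((- x * q ^ (2 * j + 1) * v) / u)"
    proof -
      have "v / (- x * w * u) = q / x ^ 2 * ((- x * w' * v) / u)" if "q * (w * w') = 1" for w w'
      proof -
        have "w \<noteq> 0" using that by auto
        then show ?thesis using that x0 uv by (simp add: field_simps power2_eq_square)
      qed
      then show ?thesis using qq .
    qed
    also have "P (Suc i) * \<dots> = (- x) ^ h * q ^ (h ^ 2) * (q / x ^ 2) ^ Suc j * (P j * ((- x * q ^ (2 * j + 1) * v) / u))"
      unfolding IH by simp
    also have "P j * ((- x * q ^ (2 * j + 1) * v) / u) = P (Suc j)"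
      unfolding PS r2 u_def v_def ..
    finally show ?case unfolding i P_def .
  qed
qed

text \<open>Reversal is applied at x = a, at x = 1/a and twice at x = 1. The powers of a cancel and
  the remaining weight is q^(4 j + 1), which the quotient of the two q-integers turns into
  -1.\<close>

lemma reg_term_reverse:
  fixes q a :: "'a::field"
  assumes a0: "a \<noteq> 0" and qh: "q ^ (2 * h + 1) = 1"
    and q2: "\<And>i. 0 < i \<Longrightarrow> i < 2 * h + 1 \<Longrightarrow> q ^ (2 * i) \<noteq> 1"
    and q1: "\<And>i. 0 < i \<Longrightarrow> i < 2 * h + 1 \<Longrightarrow> q ^ i \<noteq> 1" and "q \<noteq> 1"
    and aq: "\<And>i. a * q ^ i \<noteq> 1" and qa: "\<And>i. q ^ i \<noteq> a" and "j \<le> h"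
  shows "reg_term a q (h - j) = - reg_term a q j"
proof -
  define P where "P = (\<lambda>x k. qpoch (x * q) (q ^ 2) k / qpoch (q ^ 2 / x) (q ^ 2) k)"
  have R: "reg_term a q k = qint q (4 * k + 1) * (P a k * P (inverse a) k * P 1 k ^ 2)" if "k \<le> h" for k
  proof -
    have "central_ratio q k = P 1 k"
      using that q2 by (subst central_ratio_eq) (auto simp: P_def)
    then show ?thesis
      by (simp add: reg_term_def P_def divide_inverse mult_ac)
  qed
  have Prev: "P x (h - j) = (- x) ^ h * q ^ (h ^ 2) * (q / x ^ 2) ^ j * P x j"
    if "x \<noteq> 0" "\<And>i. i < h \<Longrightarrow> x * q ^ (2 * i + 1) \<noteq> 1" for x
    unfolding P_def using that qh \<open>j \<le> h\<close> by (intro qpoch_ratio_reverse)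
  have Pa: "P a (h - j) = (- a) ^ h * q ^ (h ^ 2) * (q / a ^ 2) ^ j * P a j"
    using a0 aq by (intro Prev)
  have Pb: "P (inverse a) (h - j) = (- inverse a) ^ h * q ^ (h ^ 2) * (q / inverse a ^ 2) ^ j * P (inverse a) j"
  proof (intro Prev)
    show "inverse a * q ^ (2 * i + 1) \<noteq> 1" for i
      using qa[of "2 * i + 1"] a0 by (simp only: field_simps) simp
  qed (use a0 in simp)
  have P1: "P 1 (h - j) = (- 1) ^ h * q ^ (h ^ 2) * (q / 1 ^ 2) ^ j * P 1 j"
  proof (intro Prev)
    show "1 * q ^ (2 * i + 1) \<noteq> 1" if "i < h" for i
      using q1[of "2 * i + 1"] that by simp
  qed simp
  have q0: "q \<noteq> 0" using qh by (metis power_0_left add_is_0 one_neq_zero zero_neq_one)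
  define W where "W = (\<lambda>k. P a k * P (inverse a) k * P 1 k ^ 2)"
  have W: "W (h - j) = q * q ^ (4 * j) * W j"
  proof -
    have e1: "(- a) ^ h * (- inverse a) ^ h = 1"
      using a0 by (simp add: power_mult_distrib[symmetric])
    have e2: "(q / a ^ 2) ^ j * (q / inverse a ^ 2) ^ j = q ^ (2 * j)"
    proof -
      have "q / a ^ 2 * (q / inverse a ^ 2) = q ^ 2"
        using a0 by (simp add: power_inverse[symmetric] divide_simps power2_eq_square)
      then show ?thesis by (simp only: power_mult_distrib[symmetric] power_mult)
    qed
    \<comment> \<open>Modulo 2 h + 1 one has 2 h = -1, hence 4 h^2 = 1.\<close>
    have e3: "q ^ (h ^ 2) * q ^ (h ^ 2) * (q ^ (h ^ 2)) ^ 2 = q"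
    proof -
      have "q ^ (h ^ 2) * q ^ (h ^ 2) * (q ^ (h ^ 2)) ^ 2 * q ^ (2 * h) = (q ^ (2 * h + 1)) ^ (2 * h)"
        unfolding power_add[symmetric] power_mult[symmetric]
        by (rule arg_cong[of _ _ "power q"]) (simp add: power2_eq_square algebra_simps)
      also have "\<dots> = q * q ^ (2 * h)" using qh by simp
      finally show ?thesis using q0 by simp
    qed
    have e4: "(((- 1) ^ h) ^ 2 :: 'a) = 1"
      by (simp add: power_mult[symmetric] mult.commute[of h 2])
    have "W (h - j) = ((- a) ^ h * (- inverse a) ^ h) * (q ^ (h ^ 2) * q ^ (h ^ 2) * (q ^ (h ^ 2)) ^ 2)
        * ((q / a ^ 2) ^ j * (q / inverse a ^ 2) ^ j) * ((- 1) ^ h) ^ 2 * (q ^ j) ^ 2 * W j"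
      unfolding W_def Pa Pb P1 by (simp only: power_mult_distrib mult_ac power_one div_by_1)
    also have "\<dots> = q * q ^ (4 * j) * W j"
    proof -
      have "q ^ (2 * j) * (q ^ j) ^ 2 = q ^ (4 * j)"
        unfolding power_add[symmetric] power_mult[symmetric] by simp
      then show ?thesis unfolding e1 e2 e3 e4 by (metis mult.assoc mult_1)
    qed
    finally show ?thesis .
  qed
  \<comment> \<open>The exponents add up to 4 h + 2, twice the order.\<close>
  have "q ^ (4 * (h - j) + 1) * (q * q ^ (4 * j)) = 1"
  proof -
    have "q ^ (4 * (h - j) + 1) * (q * q ^ (4 * j)) = (q ^ (2 * h + 1)) ^ 2"
      unfolding power_add[symmetric] power_mult[symmetric] power_Suc[symmetric]
      by (rule arg_cong[of _ _ "power q"]) (use \<open>j \<le> h\<close> in simp)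
    then show ?thesis unfolding qh by simp
  qed
  then have "qint q (4 * (h - j) + 1) * (q * q ^ (4 * j)) = - qint q (4 * j + 1)"
  proof -
    assume *: "q ^ (4 * (h - j) + 1) * (q * q ^ (4 * j)) = 1"
    have "(1 - q ^ (4 * (h - j) + 1)) * (q * q ^ (4 * j)) = - (1 - q ^ (4 * j + 1))"
      unfolding left_diff_distrib * by simp
    then show ?thesis using \<open>q \<noteq> 1\<close> unfolding qint_eq[OF \<open>q \<noteq> 1\<close>]
      by (metis minus_divide_left times_divide_eq_left)
  qed
  moreover have "reg_term a q (h - j) = qint q (4 * (h - j) + 1) * W (h - j)"
    unfolding W_def by (intro R) simp
  moreover have "reg_term a q j = qint q (4 * j + 1) * W j"
    unfolding W_def using \<open>j \<le> h\<close> by (rule R)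
  ultimately show ?thesis
    unfolding W by (metis (no_types, lifting) mult.assoc mult_minus_left)
qed

text \<open>\<open>2 * h + 1\<close> is the exact order of q. Being odd, it is also the order of
  q^2, which gives the last property.\<close>

lemma root_of_unity_order:
  fixes q :: "'a::field"
  assumes "q ^ M = 1" and "q \<noteq> 1" and "odd M"
  obtains h L where "h > 0" and "M = L * (2 * h + 1)" and "odd L" and "q ^ (2 * h + 1) = 1"
    and "\<And>i. 0 < i \<Longrightarrow> i < 2 * h + 1 \<Longrightarrow> q ^ i \<noteq> 1"
    and "\<And>i. 0 < i \<Longrightarrow> i < 2 * h + 1 \<Longrightarrow> q ^ (2 * i) \<noteq> 1"
proof -
  define m where "m = (LEAST m. 0 < m \<and> q ^ m = 1)"
  have "0 < M" using \<open>odd M\<close> by (rule odd_pos)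
  then have m: "0 < m" "q ^ m = 1"
    unfolding m_def using LeastI[of "\<lambda>m. 0 < m \<and> q ^ m = 1" M] assms(1) by auto
  have least: "q ^ i \<noteq> 1" if "0 < i" "i < m" for i
    using that not_less_Least[of i "\<lambda>m. 0 < m \<and> q ^ m = 1"] unfolding m_def by auto
  have dvd: "m dvd i" if "q ^ i = 1" for i
  proof -
    have "q ^ i = (q ^ m) ^ (i div m) * q ^ (i mod m)"
      by (simp flip: power_mult power_add)
    then have "q ^ (i mod m) = 1" using that m by simp
    then have "i mod m = 0" using least[of "i mod m"] m(1) by (cases "i mod m = 0") auto
    then show ?thesis by auto
  qed
  obtain L where L: "M = L * m" using dvd[OF assms(1)] by (metis dvdE mult.commute)
  then have "odd m" "odd L" using \<open>odd M\<close> by auto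
  then obtain h where h: "m = 2 * h + 1" by (auto elim!: oddE)
  show thesis
  proof (rule that[of h L])
    show "h > 0" using h m \<open>q \<noteq> 1\<close> by (cases h) auto
    show "q ^ (2 * i) \<noteq> 1" if "0 < i" "i < 2 * h + 1" for i
    proof
      assume "q ^ (2 * i) = 1"
      then have "m dvd 2 * i" by (rule dvd)
      then have "m dvd i" using \<open>odd m\<close> by (simp add: coprime_dvd_mult_right_iff)
      then show False using that h by (auto dest: dvd_imp_le)
    qed
  qed (use L h m least \<open>odd L\<close> in auto)
qed

text \<open>Each block is \<open>f (l * m)\<close> times the first one, whatever that factor is. The
  incomplete block of length s covers both cutoffs: s = 0 for d = 1 and a half block for d =
  2.\<close>

lemma sum_blocks_eq_0:
  fixes f :: "nat \<Rightarrow> 'a::comm_ring_1"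
  assumes "\<And>l j. j < m \<Longrightarrow> f (l * m + j) = f (l * m) * f j" and "sum f {..<m} = 0" and "sum f {..<s} = 0" and "s \<le> m"
  shows "sum f {..<l * m + s} = 0"
proof -
  have split: "sum f {..<l * m + t} = sum f {..<l * m} + f (l * m) * sum f {..<t}" if "t \<le> m" for l t
    using that
  proof (induction t)
    case (Suc t)
    then show ?case using assms(1)[of t l] by (simp add: algebra_simps)
  qed simp
  have "sum f {..<l * m} = 0" for l
  proof (induction l)
    case (Suc l)
    have "Suc l * m = l * m + m" by simp
    then show ?case using split[of m l] Suc assms(2) by (simp only: order_refl mult_zero_right add_0)
  qed simp
  then show ?thesis using split[OF assms(4), of l] assms(3) by simp
qed

lemma reg_sum_root_of_unity:
  fixes q a :: "'a::field_char_0"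
  assumes a0: "a \<noteq> 0" and aq: "\<And>i. a * q ^ i \<noteq> 1" and qa: "\<And>i. q ^ i \<noteq> a"
    and "q ^ M = 1" and "q \<noteq> 1" and "odd M" and d: "d \<in> {1, 2}"
  shows "(\<Sum>k\<le>(M - 1) div d. reg_term a q k) = 0"
proof -
  obtain h L where h: "h > 0" and M: "M = L * (2 * h + 1)" and "odd L" and qh: "q ^ (2 * h + 1) = 1"
    and q1: "\<And>i. 0 < i \<Longrightarrow> i < 2 * h + 1 \<Longrightarrow> q ^ i \<noteq> 1"
    and q2: "\<And>i. 0 < i \<Longrightarrow> i < 2 * h + 1 \<Longrightarrow> q ^ (2 * i) \<noteq> 1"
    using root_of_unity_order[OF assms(4-6)] by (metis (no_types, lifting))
  define f where "f = reg_term a q"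
  have half: "sum f {..<Suc h} = 0"
  proof -
    have "sum f {..<Suc h} = (\<Sum>j<Suc h. f (Suc h - Suc j))"
      by (rule sum.nat_diff_reindex[symmetric])
    also have "\<dots> = (\<Sum>j<Suc h. - f j)"
      unfolding f_def using a0 qh q2 q1 \<open>q \<noteq> 1\<close> aq qa
      by (intro sum.cong refl) (auto intro!: reg_term_reverse)
    also have "\<dots> = - sum f {..<Suc h}" by (rule sum_negf)
    finally have "2 * sum f {..<Suc h} = 0" unfolding eq_neg_iff_add_eq_0 mult_2 .
    then show ?thesis unfolding mult_eq_0_iff by simp
  qed
  have full: "sum f {..<2 * h + 1} = 0"
  proof -
    have "sum f {..<Suc h} = sum f {..<2 * h + 1}"
      by (rule sum.mono_neutral_left)
        (use q2 qh in \<open>auto simp: f_def reg_term_def intro!: central_ratio_eq_0\<close>)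
    then show ?thesis using half by simp
  qed
  have block: "f (l * (2 * h + 1) + j) = f (l * (2 * h + 1)) * f j" if "j < 2 * h + 1" for l j
    unfolding f_def by (rule reg_term_block) (use that q2 qh \<open>q \<noteq> 1\<close> in auto)
  have "sum f {..<Suc ((M - 1) div d)} = 0"
  proof (cases "d = 1")
    case True
    have "M > 0" using \<open>odd M\<close> by (rule odd_pos)
    then have "Suc ((M - 1) div d) = L * (2 * h + 1) + 0" using True M by simp
    then show ?thesis using sum_blocks_eq_0[of "2 * h + 1" f 0 L] block full by simp
  next
    case False
    then have "d = 2" using d by auto
    moreover obtain l where "L = 2 * l + 1" using \<open>odd L\<close> by (auto elim!: oddE)
    \<comment> \<open>The (M + 1) / 2 terms are l full blocks followed by a first half of h + 1
      terms.\<close>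
    ultimately have "Suc ((M - 1) div d) = l * (2 * h + 1) + Suc h"
      using M by (simp add: algebra_simps)
    then show ?thesis using sum_blocks_eq_0[of "2 * h + 1" f "Suc h" l] block full half by simp
  qed
  then show ?thesis unfolding f_def lessThan_Suc_atMost .
qed

section \<open>Evaluation and localisation of rational functions\<close>

definition ring_hom_like :: "('a::comm_ring_1 \<Rightarrow> 'b::comm_ring_1) \<Rightarrow> bool" where
  "ring_hom_like f \<longleftrightarrow> f 0 = 0 \<and> f 1 = 1 \<and> (\<forall>x y. f (x + y) = f x + f y) \<and> (\<forall>x y. f (x * y) = f x * f y)"

lemma ring_hom_likeD:
  assumes "ring_hom_like f"
  shows "f 0 = 0" and "f 1 = 1" and "f (x + y) = f x + f y" and "f (x * y) = f x * f y"
  using assms by (auto simp: ring_hom_like_def)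

lemma ring_hom_like_uminus: "ring_hom_like f \<Longrightarrow> f (- x) = - f x"
  using ring_hom_likeD(1)[of f] ring_hom_likeD(3)[of f x "- x"]
  by (simp add: eq_neg_iff_add_eq_0 add.commute)

lemma ring_hom_like_diff: "ring_hom_like f \<Longrightarrow> f (x - y) = f x - f y"
  using ring_hom_likeD(3)[of f x "- y"] ring_hom_like_uminus[of f y] by simp

lemma ring_hom_like_power: "ring_hom_like f \<Longrightarrow> f (x ^ n) = f x ^ n"
  by (induction n) (simp_all add: ring_hom_likeD)

lemma map_poly_mult_hom:
  assumes f: "ring_hom_like f"
  shows "map_poly f (p * q) = map_poly f p * map_poly f q"
proof (induction p)
  case (pCons c p)
  have add: "map_poly f (p + q) = map_poly f p + map_poly f q" for p q
    by (intro poly_eqI) (simp add: coeff_map_poly ring_hom_likeD[OF f])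
  show ?case
    using pCons by (simp add: add map_poly_smult map_poly_pCons ring_hom_likeD[OF f])
qed simp

text \<open>The construction iterates: from the embedding of the integers it yields evaluation in q,
  and from that evaluation in both variables.\<close>

lemma ring_hom_like_poly_map_poly:
  assumes f: "ring_hom_like f"
  shows "ring_hom_like (\<lambda>p. poly (map_poly f p) x)"
proof -
  have "map_poly f (p + q) = map_poly f p + map_poly f q" for p q
    by (intro poly_eqI) (simp add: coeff_map_poly ring_hom_likeD[OF f])
  then show ?thesis
    using ring_hom_likeD[OF f] by (simp add: ring_hom_like_def map_poly_mult_hom[OF f])
qed

definition eval1 :: "complex \<Rightarrow> int poly \<Rightarrow> complex" where
  "eval1 z c = poly (map_poly of_int c) z"

definition eval2 :: "complex \<Rightarrow> complex \<Rightarrow> bipoly \<Rightarrow> complex" where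
  "eval2 z x p = poly (map_poly (eval1 z) p) x"

lemma ring_hom_like_eval1: "ring_hom_like (eval1 z)"
  unfolding eval1_def[abs_def]
  by (rule ring_hom_like_poly_map_poly) (simp add: ring_hom_like_def)

lemma ring_hom_like_eval2: "ring_hom_like (eval2 z x)"
  unfolding eval2_def[abs_def] by (rule ring_hom_like_poly_map_poly[OF ring_hom_like_eval1])

lemmas eval1_simps = ring_hom_likeD[OF ring_hom_like_eval1] ring_hom_like_power[OF ring_hom_like_eval1]
  ring_hom_like_diff[OF ring_hom_like_eval1] ring_hom_like_uminus[OF ring_hom_like_eval1]

lemmas eval2_simps = ring_hom_likeD[OF ring_hom_like_eval2] ring_hom_like_power[OF ring_hom_like_eval2]
  ring_hom_like_diff[OF ring_hom_like_eval2] ring_hom_like_uminus[OF ring_hom_like_eval2]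

lemma eval1_var: "eval1 z [:0, 1:] = z"
  by (simp add: eval1_def map_poly_pCons)

lemma eval2_var: "eval2 z x var_a = x" "eval2 z x var_q = z"
  by (simp_all add: eval2_def var_a_def var_q_def map_poly_pCons eval1_simps eval1_var)

text \<open>A relation, because a value exists only if some representation of the fraction has a
  denominator that is nonzero at the point.\<close>

definition has_val :: "complex \<Rightarrow> complex \<Rightarrow> ratfun \<Rightarrow> complex \<Rightarrow> bool" where
  "has_val z x r v \<longleftrightarrow>
     (\<exists>N D. eval2 z x D \<noteq> 0 \<and> r = to_fract N / to_fract D \<and> v = eval2 z x N / eval2 z x D)"

text \<open>Cross multiplication with a representation that is regular at the point. The given
  \<open>D\<close> may itself vanish there.\<close>

lemma has_val_0_numerator:
  assumes "has_val z x (to_fract N / to_fract D) 0" and "D \<noteq> 0"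
  shows "eval2 z x N = 0"
proof -
  obtain N' D' where *: "eval2 z x D' \<noteq> 0" "to_fract N / to_fract D = to_fract N' / to_fract D'"
      "0 = eval2 z x N' / eval2 z x D'"
    using assms(1) unfolding has_val_def by blast
  have "D' \<noteq> 0" using *(1) by (auto simp: eval2_simps)
  then have "to_fract N * to_fract D' = to_fract N' * to_fract D"
    using *(2) \<open>D \<noteq> 0\<close> by (simp add: frac_eq_eq)
  then have "N * D' = N' * D"
    unfolding to_fract_mult[symmetric] by (simp only: to_fract_eq_iff)
  then have "eval2 z x N * eval2 z x D' = eval2 z x N' * eval2 z x D"
    by (metis eval2_simps(4))
  then show ?thesis using *(1,3) by simp
qed

lemma has_val_to_fract: "has_val z x (to_fract p) (eval2 z x p)"
  unfolding has_val_def by (intro exI[of _ p] exI[of _ 1]) (simp add: eval2_simps)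

lemma has_val_1: "has_val z x 1 1"
  using has_val_to_fract[of z x 1] by (simp add: eval2_simps)

lemma has_val_0: "has_val z x 0 0"
  using has_val_to_fract[of z x 0] by (simp add: eval2_simps)

lemma has_val_var: "has_val z x qa x" "has_val z x qq z"
  using has_val_to_fract[of z x var_a] has_val_to_fract[of z x var_q]
  by (simp_all add: qa_def qq_def eval2_var)

lemma has_val_add:
  assumes "has_val z x r v" and "has_val z x s w"
  shows "has_val z x (r + s) (v + w)"
proof -
  obtain N D where 1: "eval2 z x D \<noteq> 0" "r = to_fract N / to_fract D" "v = eval2 z x N / eval2 z x D"
    using assms(1) unfolding has_val_def by blast
  obtain N' D' where 2: "eval2 z x D' \<noteq> 0" "s = to_fract N' / to_fract D'" "w = eval2 z x N' / eval2 z x D'"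
    using assms(2) unfolding has_val_def by blast
  have "D \<noteq> 0" "D' \<noteq> 0" using 1(1) 2(1) by (auto simp: eval2_simps)
  then show ?thesis
    using 1 2 unfolding has_val_def
    by (intro exI[of _ "N * D' + N' * D"] exI[of _ "D * D'"]) (simp add: eval2_simps add_frac_eq)
qed

lemma has_val_mult:
  assumes "has_val z x r v" and "has_val z x s w"
  shows "has_val z x (r * s) (v * w)"
proof -
  obtain N D where 1: "eval2 z x D \<noteq> 0" "r = to_fract N / to_fract D" "v = eval2 z x N / eval2 z x D"
    using assms(1) unfolding has_val_def by blast
  obtain N' D' where 2: "eval2 z x D' \<noteq> 0" "s = to_fract N' / to_fract D'" "w = eval2 z x N' / eval2 z x D'"
    using assms(2) unfolding has_val_def by blast
  show ?thesis
    using 1 2 unfolding has_val_def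
    by (intro exI[of _ "N * N'"] exI[of _ "D * D'"]) (simp add: eval2_simps)
qed

lemma has_val_inverse:
  assumes "has_val z x r v" and "v \<noteq> 0"
  shows "has_val z x (inverse r) (inverse v)"
proof -
  obtain N D where 1: "eval2 z x D \<noteq> 0" "r = to_fract N / to_fract D" "v = eval2 z x N / eval2 z x D"
    using assms(1) unfolding has_val_def by blast
  then show ?thesis
    using assms(2) unfolding has_val_def
    by (intro exI[of _ D] exI[of _ N]) simp
qed

lemma has_val_uminus: "has_val z x r v \<Longrightarrow> has_val z x (- r) (- v)"
  using has_val_mult[OF has_val_to_fract[of z x "-1"]] by (fastforce simp: eval2_simps)

lemma has_val_diff: "has_val z x r v \<Longrightarrow> has_val z x s w \<Longrightarrow> has_val z x (r - s) (v - w)"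
  using has_val_add[OF _ has_val_uminus] by fastforce

lemma has_val_divide:
  "has_val z x r v \<Longrightarrow> has_val z x s w \<Longrightarrow> w \<noteq> 0 \<Longrightarrow> has_val z x (r / s) (v / w)"
  unfolding divide_inverse by (intro has_val_mult has_val_inverse)

lemma has_val_power: "has_val z x r v \<Longrightarrow> has_val z x (r ^ k) (v ^ k)"
  by (induction k) (auto intro: has_val_mult has_val_1)

lemma has_val_sum:
  "(\<And>i. i \<in> A \<Longrightarrow> has_val z x (f i) (g i)) \<Longrightarrow> has_val z x (sum f A) (sum g A)"
  by (induction A rule: infinite_finite_induct) (auto intro: has_val_add has_val_0)

lemma has_val_prod:
  "(\<And>i. i \<in> A \<Longrightarrow> has_val z x (f i) (g i)) \<Longrightarrow> has_val z x (prod f A) (prod g A)"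
  by (induction A rule: infinite_finite_induct) (auto intro: has_val_mult has_val_1)

lemma has_val_qpoch:
  "has_val z x r v \<Longrightarrow> has_val z x s w \<Longrightarrow> has_val z x (qpoch r s k) (qpoch v w k)"
  unfolding qpoch_def by (intro has_val_prod has_val_diff has_val_mult has_val_power has_val_1)

lemma has_val_qint: "has_val z x r v \<Longrightarrow> has_val z x (qint r k) (qint v k)"
  unfolding qint_def by (intro has_val_sum has_val_power)

lemma has_val_qbinom:
  assumes "has_val z x r v"
  shows "has_val z x (qbinom r k l) (qbinom v k l)"
  using assms
  by (induction v k l rule: qbinom.induct)
    (auto intro!: has_val_1 has_val_add has_val_mult has_val_power simp del: power_Suc)

lemma has_val_reg_term:
  assumes "has_val z x a \<alpha>" and "has_val z x q w" and "\<alpha> \<noteq> 0" and "\<And>i. w ^ i \<noteq> - 1"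
    and "\<And>i. \<alpha> * w ^ (2 * i) \<noteq> 1" and "\<And>i. w ^ (2 * i) \<noteq> \<alpha>"
  shows "has_val z x (reg_term a q k) (reg_term \<alpha> w k)"
proof -
  have 1: "qpoch (- w) w k \<noteq> 0"
    using assms(4)[of "Suc _"] by (auto simp: qpoch_eq_0_iff) (metis minus_minus)
  have e: "w ^ 2 * (w ^ 2) ^ i = w ^ (2 * Suc i)" for i
    by (simp add: power_mult power2_eq_square)
  have 2: "qpoch (\<alpha> * w ^ 2) (w ^ 2) k \<noteq> 0"
    using assms(5)[of "Suc _"] e by (auto simp: qpoch_eq_0_iff mult.assoc)
  have 3: "qpoch (w ^ 2 / \<alpha>) (w ^ 2) k \<noteq> 0"
    using assms(6)[of "Suc _"] assms(3) e by (auto simp: qpoch_eq_0_iff divide_eq_eq)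
  show ?thesis
    unfolding reg_term_def central_ratio_def
    using 1 2 3 assms(1,2,3)
    by (intro has_val_mult has_val_divide has_val_qpoch has_val_qint has_val_power has_val_qbinom has_val_uminus) auto
qed

text \<open>The ring of fractions with denominators prime to \<open>P\<close>. Membership of the
  difference of the two sides yields the denominator required by \<open>cong_rf\<close>.\<close>

definition localized :: "bipoly \<Rightarrow> ratfun \<Rightarrow> bool" where
  "localized P r \<longleftrightarrow> (\<exists>N D. D \<noteq> 0 \<and> coprime D P \<and> r = to_fract N / to_fract D)"

lemma localized_to_fract: "localized P (to_fract p)"
  unfolding localized_def by (intro exI[of _ p] exI[of _ 1]) simp

lemma localized_0: "localized P 0" and localized_1: "localized P 1"
  using localized_to_fract[of P 0] localized_to_fract[of P 1] by simp_all

lemma localized_add: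
  assumes "localized P r" and "localized P s"
  shows "localized P (r + s)"
proof -
  obtain N D where 1: "D \<noteq> 0" "coprime D P" "r = to_fract N / to_fract D"
    using assms(1) unfolding localized_def by blast
  obtain N' D' where 2: "D' \<noteq> 0" "coprime D' P" "s = to_fract N' / to_fract D'"
    using assms(2) unfolding localized_def by blast
  show ?thesis
    using 1 2 unfolding localized_def
    by (intro exI[of _ "N * D' + N' * D"] exI[of _ "D * D'"]) (simp add: add_frac_eq)
qed

lemma localized_mult:
  assumes "localized P r" and "localized P s"
  shows "localized P (r * s)"
proof -
  obtain N D where 1: "D \<noteq> 0" "coprime D P" "r = to_fract N / to_fract D"
    using assms(1) unfolding localized_def by blast
  obtain N' D' where 2: "D' \<noteq> 0" "coprime D' P" "s = to_fract N' / to_fract D'"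
    using assms(2) unfolding localized_def by blast
  show ?thesis
    using 1 2 unfolding localized_def
    by (intro exI[of _ "N * N'"] exI[of _ "D * D'"]) simp
qed

lemma localized_uminus: "localized P r \<Longrightarrow> localized P (- r)"
  using localized_mult[OF localized_to_fract[of P "-1"], of r] by simp

lemma localized_diff: "localized P r \<Longrightarrow> localized P s \<Longrightarrow> localized P (r - s)"
  using localized_add[OF _ localized_uminus] by fastforce

lemma localized_power: "localized P r \<Longrightarrow> localized P (r ^ k)"
  by (induction k) (auto intro: localized_mult localized_1)

lemma localized_sum: "(\<And>i. i \<in> A \<Longrightarrow> localized P (f i)) \<Longrightarrow> localized P (sum f A)"
  by (induction A rule: infinite_finite_induct) (auto intro: localized_add localized_0)

lemma localized_prod: "(\<And>i. i \<in> A \<Longrightarrow> localized P (f i)) \<Longrightarrow> localized P (prod f A)"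
  by (induction A rule: infinite_finite_induct) (auto intro: localized_mult localized_1)

lemma localized_inverse: "D \<noteq> 0 \<Longrightarrow> coprime D P \<Longrightarrow> localized P (inverse (to_fract D))"
  unfolding localized_def by (intro exI[of _ 1] exI[of _ D]) (simp add: divide_inverse)

lemma localized_qpoch: "localized P r \<Longrightarrow> localized P s \<Longrightarrow> localized P (qpoch r s k)"
  unfolding qpoch_def by (intro localized_prod localized_diff localized_mult localized_power localized_1)

lemma localized_inverse_qpoch:
  "(\<And>i. localized P (inverse (1 - r * s ^ i))) \<Longrightarrow> localized P (inverse (qpoch r s k))"
  unfolding qpoch_def prod_inversef[symmetric] by (intro localized_prod) (simp add: o_def)

lemma localized_qint: "localized P r \<Longrightarrow> localized P (qint r k)"
  unfolding qint_def by (intro localized_sum localized_power)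

lemma localized_qbinom:
  assumes "localized P r"
  shows "localized P (qbinom r k l)"
  using assms
  by (induction r k l rule: qbinom.induct)
    (auto intro!: localized_1 localized_add localized_mult localized_power simp del: power_Suc)

lemma qa_nonzero: "qa \<noteq> 0"
  by (simp add: qa_def var_a_def)

lemma to_fract_power: "to_fract (p ^ k) = to_fract p ^ k"
  by (induction k) simp_all

text \<open>The hypotheses list the irregular factors: \<open>var_a\<close> because of q / a in the
  numerator, the others because of the denominators. The parameter s is 1 for the left sum and n for
  the right one.\<close>

lemma localized_reg_term:
  assumes cop: "coprime var_a P" "\<And>i. i > 0 \<Longrightarrow> coprime (1 + var_q ^ i) P"
      "\<And>i. coprime (1 - var_a * var_q ^ (2 * i)) P" "\<And>i. coprime (var_a - var_q ^ (2 * i)) P"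
    and "s > 0"
  shows "localized P (reg_term qa (qq ^ s) k)"
proof -
  have q: "localized P qq" and a: "localized P qa" and a': "localized P (inverse qa)"
    using cop(1) by (simp_all add: qq_def qa_def localized_to_fract localized_inverse var_a_def)
  have pw: "(qq ^ s) ^ 2 * ((qq ^ s) ^ 2) ^ i = qq ^ (2 * (s * Suc i))" for i
    by (simp add: power_add algebra_simps flip: power_mult)
  have 1: "localized P (inverse (1 - - (qq ^ s) * (qq ^ s) ^ i))" for i
  proof -
    have "1 - - (qq ^ s) * (qq ^ s) ^ i = to_fract (1 + var_q ^ (s * Suc i))"
      by (simp add: qq_def to_fract_power power_add power_mult)
    moreover have "1 + var_q ^ (s * Suc i) \<noteq> 0"
    proof
      assume "1 + var_q ^ (s * Suc i) = 0"
      then have "eval2 1 1 (1 + var_q ^ (s * Suc i)) = 0" by (simp add: eval2_simps)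
      then show False by (simp add: eval2_simps eval2_var)
    qed
    moreover have "coprime (1 + var_q ^ (s * Suc i)) P" using \<open>s > 0\<close> by (intro cop(2)) simp
    ultimately show ?thesis by (simp only: not_False_eq_True localized_inverse)
  qed
  have 2: "localized P (inverse (1 - qa * (qq ^ s) ^ 2 * ((qq ^ s) ^ 2) ^ i))" for i
  proof -
    have "1 - qa * (qq ^ s) ^ 2 * ((qq ^ s) ^ 2) ^ i = to_fract (1 - var_a * var_q ^ (2 * (s * Suc i)))"
      unfolding mult.assoc pw by (simp add: qq_def qa_def to_fract_power)
    moreover have "1 - var_a * var_q ^ (2 * (s * Suc i)) \<noteq> 0"
    proof
      assume "1 - var_a * var_q ^ (2 * (s * Suc i)) = 0"
      then have "eval2 1 0 (1 - var_a * var_q ^ (2 * (s * Suc i))) = 0" by (simp add: eval2_simps)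
      then show False by (simp add: eval2_simps eval2_var)
    qed
    ultimately show ?thesis by (simp only: not_False_eq_True localized_inverse cop(3))
  qed
  have 3: "localized P (inverse (1 - (qq ^ s) ^ 2 / qa * ((qq ^ s) ^ 2) ^ i))" for i
  proof -
    have "1 - (qq ^ s) ^ 2 / qa * ((qq ^ s) ^ 2) ^ i = (qa - (qq ^ s) ^ 2 * ((qq ^ s) ^ 2) ^ i) / qa"
      using qa_nonzero by (simp add: diff_divide_distrib)
    also have "\<dots> = to_fract (var_a - var_q ^ (2 * (s * Suc i))) / qa"
      unfolding pw by (simp add: qq_def qa_def to_fract_power)
    finally have "inverse (1 - (qq ^ s) ^ 2 / qa * ((qq ^ s) ^ 2) ^ i)
      = inverse (to_fract (var_a - var_q ^ (2 * (s * Suc i)))) * qa"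
      by (simp add: inverse_eq_divide)
    moreover have "var_a - var_q ^ (2 * (s * Suc i)) \<noteq> 0"
    proof
      assume "var_a - var_q ^ (2 * (s * Suc i)) = 0"
      then have "eval2 1 0 (var_a - var_q ^ (2 * (s * Suc i))) = 0" by (simp add: eval2_simps)
      then show False by (simp add: eval2_simps eval2_var)
    qed
    ultimately show ?thesis by (simp only: not_False_eq_True localized_inverse cop(4) localized_mult a)
  qed
  show ?thesis
    unfolding reg_term_def central_ratio_def divide_inverse inverse_mult_distrib power_inverse[symmetric]
    using 1 2 3 q a a'
    by (intro localized_mult localized_qint localized_qpoch localized_power localized_qbinom localized_inverse_qpoch) (auto simp: divide_inverse)
qed

section \<open>Coprimality of the factors of the modulus and of the denominators\<close>

text \<open>In Z[q][a] coprime elements need not generate 1. It suffices that a combination is free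
  of a: a common divisor is then free of a too, and divides the unit coefficient of
  \<open>p\<close>.\<close>

lemma bipoly_coprimeI:
  assumes "u * p + v * p' = [:c:]" and "c \<noteq> 0" and "coeff p i dvd 1"
  shows "coprime p (p' :: bipoly)"
proof (rule coprimeI)
  fix d assume d: "d dvd p" "d dvd p'"
  then have "d dvd [:c:]" unfolding assms(1)[symmetric] by simp
  then have "degree d = 0" using \<open>c \<noteq> 0\<close> dvd_imp_degree_le[of d "[:c:]"] by simp
  then obtain e where e: "d = [:e:]" by (metis degree_eq_zeroE)
  then have "e dvd coeff p i" using d(1) by (simp add: const_poly_dvd_iff)
  then have "e dvd 1" using assms(3) dvd_trans by blast
  then show "is_unit d" unfolding e by (simp add: is_unit_const_poly_iff)
qed

lemma var_q_power: "var_q ^ s = [:[:0, 1:] ^ s:]"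
  by (simp add: var_q_def poly_const_pow)

lemma var_power_eq_iff: "[:0, 1:] ^ s = ([:0, 1:] ^ t :: int poly) \<longleftrightarrow> s = t"
  by (metis degree_linear_power)

lemma coprime_one_minus_one_minus: "s \<noteq> t \<Longrightarrow> coprime (1 - var_a * var_q ^ s) (1 - var_a * var_q ^ t)"
  by (rule bipoly_coprimeI[of "var_q ^ t" _ "- (var_q ^ s)" _ "[:0, 1:] ^ t - [:0, 1:] ^ s" 0])
    (auto simp: algebra_simps var_q_power var_a_def var_power_eq_iff)

lemma coprime_a_minus_a_minus: "s \<noteq> t \<Longrightarrow> coprime (var_a - var_q ^ s) (var_a - var_q ^ t)"
  by (rule bipoly_coprimeI[of 1 _ "-1" _ "[:0, 1:] ^ t - [:0, 1:] ^ s" 1])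
    (auto simp: algebra_simps var_q_power var_a_def var_power_eq_iff)

lemma coprime_one_minus_a_minus: "s + t > 0 \<Longrightarrow> coprime (1 - var_a * var_q ^ s) (var_a - var_q ^ t)"
  using var_power_eq_iff[of 0 "s + t"]
  by (intro bipoly_coprimeI[of 1 _ "var_q ^ s" _ "1 - [:0, 1:] ^ (s + t)" 0])
    (auto simp: algebra_simps var_q_power var_a_def power_add one_pCons)

lemma coprime_const_one_minus: "c \<noteq> 0 \<Longrightarrow> coprime [:c:] (1 - var_a * var_q ^ t)"
  by (subst coprime_commute, rule bipoly_coprimeI[of 0 _ 1 _ c 0])
    (auto simp: var_q_power var_a_def)

lemma coprime_const_a_minus: "c \<noteq> 0 \<Longrightarrow> coprime [:c:] (var_a - var_q ^ t)"
  by (subst coprime_commute, rule bipoly_coprimeI[of 0 _ 1 _ c 1])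
    (auto simp: var_q_power var_a_def)

lemma qint_var_q: "qint var_q M = [:qint [:0, 1:] M:]"
proof -
  have "[:sum f A:] = (\<Sum>x\<in>A. [:f x:])" for f :: "nat \<Rightarrow> int poly" and A
    using sum_comp_morphism[of "\<lambda>c. [:c:]" f A] by (simp add: o_def)
  then show ?thesis by (simp add: qint_def var_q_power)
qed

lemma qint_var_nonzero: "M > 0 \<Longrightarrow> qint [:0, 1::int:] M \<noteq> 0"
proof
  assume "M > 0" "qint [:0, 1::int:] M = 0"
  then have "eval1 1 (qint [:0, 1:] M) = 0" by (simp add: eval1_simps)
  moreover have "eval1 1 (qint [:0, 1:] M) = of_nat M"
    unfolding qint_def by (induction M) (simp_all add: eval1_simps eval1_var)
  ultimately show False using \<open>M > 0\<close> by simp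
qed

lemma coprime_bezout_1: "u * p + v * p' = 1 \<Longrightarrow> coprime p (p' :: 'a::algebraic_semidom)"
  by (rule coprimeI) (metis dvd_add dvd_mult)

text \<open>Since M is odd, 1 + q^i divides 1 + q^(i M), while [M] divides 1 - q^(i M). A common
  divisor thus divides 2, so it is an integer, and the constant coefficient 1 of [M] makes it a
  unit.\<close>

lemma coprime_one_plus_power_qint:
  assumes "odd M"
  shows "coprime (1 + var_q ^ i) (qint var_q M)"
proof (rule coprimeI)
  fix d assume d: "d dvd 1 + var_q ^ i" "d dvd qint var_q M"
  have "1 + var_q ^ i dvd 1 + (var_q ^ i) ^ M"
  proof -
    have "(var_q ^ i) - (- 1) dvd (var_q ^ i) ^ M - (- 1) ^ M"
      by (metis dvd_triv_left power_diff_sumr2)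
    then show ?thesis using \<open>odd M\<close> by (simp add: add.commute)
  qed
  then have 1: "d dvd 1 + var_q ^ (i * M)" using d(1) by (metis dvd_trans power_mult)
  have "1 - var_q ^ M dvd 1 - (var_q ^ M) ^ i"
    unfolding one_diff_power_eq[of "var_q ^ M" i] by simp
  moreover have "qint var_q M dvd 1 - var_q ^ M"
    unfolding qint_mult[symmetric] by simp
  ultimately have 2: "d dvd 1 - var_q ^ (i * M)" using d(2)
    by (metis dvd_trans power_mult mult.commute)
  have "d dvd (1 + var_q ^ (i * M)) + (1 - var_q ^ (i * M))"
    using 1 2 by (rule dvd_add)
  moreover have "(1 + var_q ^ (i * M)) + (1 - var_q ^ (i * M)) = [:[:2:]:]"
    by (simp add: numeral_poly)
  ultimately have "d dvd [:[:2:]:]" by simp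
  then have "degree d = 0" using dvd_imp_degree_le[of d "[:[:2:]:]"] by simp
  then obtain e where e: "d = [:e:]" by (metis degree_eq_zeroE)
  have "e dvd [:2:]" using \<open>d dvd [:[:2:]:]\<close> unfolding e by simp
  then have "degree e = 0" using dvd_imp_degree_le[of e "[:2:]"] by simp
  then obtain f where f: "e = [:f:]" by (metis degree_eq_zeroE)
  have "e dvd qint [:0, 1:] M" using d(2) unfolding e qint_var_q by simp
  then have "f dvd coeff (qint [:0, 1:] M) 0" unfolding f const_poly_dvd_iff by blast
  moreover have "coeff (qint [:0, 1:] M) 0 = (1::int)"
  proof -
    have "M > 0" using \<open>odd M\<close> by (rule odd_pos)
    then obtain m where "M = Suc m" by (cases M) auto
    then have "qint [:0, 1:] M = 1 + [:0, 1:] * (\<Sum>i<m. [:0, 1:] ^ i :: int poly)"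
      by (simp only: qint_def sum.lessThan_Suc_shift sum_distrib_left power_Suc power_0)
    then show ?thesis by simp
  qed
  ultimately show "is_unit d" unfolding e f by (simp add: is_unit_const_poly_iff)
qed

section \<open>Divisibility by the modulus\<close>

lemma eval1_infinite_zeros:
  assumes "infinite Z" and "\<And>z. z \<in> Z \<Longrightarrow> eval1 z c = 0"
  shows "c = 0"
proof -
  have "map_poly of_int c = (0 :: complex poly)"
  proof (rule ccontr)
    assume "map_poly of_int c \<noteq> (0 :: complex poly)"
    then have "finite {z. poly (map_poly of_int c) z = (0::complex)}" by (rule poly_roots_finite)
    moreover have "Z \<subseteq> {z. poly (map_poly of_int c) z = 0}"
      using assms(2) by (auto simp: eval1_def)
    ultimately show False using assms(1) finite_subset by metis
  qed
  then show ?thesis by (subst (asm) map_poly_eq_0_iff) auto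
qed

text \<open>The sum runs up to the degree before mapping, since \<open>f\<close> may annihilate
  leading coefficients; this is what reversing the coefficients requires.\<close>

lemma poly_map_poly_sum:
  fixes x :: "'b::comm_ring_1"
  assumes "f 0 = 0"
  shows "poly (map_poly f p) x = (\<Sum>i\<le>degree p. f (coeff p i) * x ^ i)"
proof -
  have "(\<Sum>i\<le>degree (map_poly f p). f (coeff p i) * x ^ i) = (\<Sum>i\<le>degree p. f (coeff p i) * x ^ i)"
  proof (rule sum.mono_neutral_left)
    show "{..degree (map_poly f p)} \<subseteq> {..degree p}" using map_poly_degree_leq[of f p] by simp
    show "\<forall>i\<in>{..degree p} - {..degree (map_poly f p)}. f (coeff p i) * x ^ i = 0"
      using coeff_eq_0[of "map_poly f p"] by (auto simp: coeff_map_poly assms)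
  qed simp
  then show ?thesis by (simp add: poly_altdef coeff_map_poly assms)
qed

lemma poly_map_reflect_poly:
  fixes x :: "'b::field"
  assumes "f 0 = 0" and "x \<noteq> 0"
  shows "poly (map_poly f (reflect_poly p)) x = x ^ degree p * poly (map_poly f p) (inverse x)"
proof -
  have "poly (map_poly f (reflect_poly p)) x = (\<Sum>i\<le>degree p. f (coeff (reflect_poly p) i) * x ^ i)"
    unfolding poly_map_poly_sum[of f, OF assms(1)]
    using degree_reflect_poly_le[of p] by (intro sum.mono_neutral_left) (auto simp: coeff_eq_0 assms)
  also have "\<dots> = (\<Sum>i\<le>degree p. f (coeff p (degree p - i)) * x ^ i)"
    by (intro sum.cong) (auto simp: coeff_reflect_poly)
  also have "\<dots> = (\<Sum>i\<le>degree p. f (coeff p i) * x ^ (degree p - i))"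
    by (rule sum.reindex_bij_witness[of _ "\<lambda>i. degree p - i" "\<lambda>i. degree p - i"]) auto
  also have "\<dots> = x ^ degree p * poly (map_poly f p) (inverse x)"
    unfolding poly_map_poly_sum[of f, OF assms(1)] sum_distrib_left
    using assms(2) by (intro sum.cong) (auto simp: power_diff field_simps)
  finally show ?thesis .
qed

lemma eval1_poly: "eval1 z (poly p u) = poly (map_poly (eval1 z) p) (eval1 z u)"
  by (induction p) (simp_all add: map_poly_pCons eval1_simps)

lemma a_minus_power_dvd:
  assumes "infinite Z" and "\<And>z. z \<in> Z \<Longrightarrow> eval2 z (z ^ s) p = 0"
  shows "var_a - var_q ^ s dvd p"
proof -
  have "poly p ([:0, 1:] ^ s) = 0"
    by (rule eval1_infinite_zeros[OF assms(1)])
      (use assms(2) in \<open>simp add: eval1_poly eval1_simps eval1_var eval2_def\<close>)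
  then show ?thesis
    by (simp add: poly_eq_0_iff_dvd var_a_def var_q_power)
qed

text \<open>The root 1/u need not lie in the ring, so the factor is found in the reversed polynomial
  and reversed back. Reversing twice restores \<open>p\<close> only if the constant coefficient is
  nonzero, which forces the case distinction.\<close>

lemma dvd_of_reflect_root:
  fixes u :: "'a::idom"
  assumes "poly (reflect_poly p) u = 0" and "u \<noteq> 0"
  shows "[:1, - u:] dvd p"
  using assms(1)
proof (induction p)
  case (pCons c p)
  show ?case
  proof (cases "c = 0")
    case True
    then have "[:1, - u:] dvd p" using pCons by (simp add: reflect_poly_pCons')
    then have "[:1, - u:] dvd [:0, 1:] * p" by (rule dvd_mult)
    then show ?thesis using True by simp
  next
    case False
    obtain g where g: "reflect_poly (pCons c p) = [:- u, 1:] * g"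
      using pCons.prems unfolding poly_eq_0_iff_dvd by (elim dvdE)
    have "pCons c p = reflect_poly (reflect_poly (pCons c p))" using False by simp
    also have "\<dots> = reflect_poly [:- u, 1:] * reflect_poly g"
      unfolding g reflect_poly_mult ..
    also have "reflect_poly [:- u, 1:] = [:1, - u:]"
      using assms(2) by (simp add: reflect_poly_def cCons_def)
    finally show ?thesis by (metis dvd_triv_left)
  qed
qed simp

lemma one_minus_a_power_dvd:
  assumes "infinite Z" and "0 \<notin> Z" and "\<And>z. z \<in> Z \<Longrightarrow> eval2 z (inverse (z ^ s)) p = 0"
  shows "1 - var_a * var_q ^ s dvd p"
proof -
  have "poly (reflect_poly p) ([:0, 1:] ^ s) = 0"
  proof (rule eval1_infinite_zeros[OF assms(1)])
    fix z assume z: "z \<in> Z"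
    then have "z ^ s \<noteq> 0" using assms(2) by auto
    then show "eval1 z (poly (reflect_poly p) ([:0, 1:] ^ s)) = 0"
      using assms(3)[OF z]
      by (simp add: eval1_poly eval1_simps eval1_var eval2_def poly_map_reflect_poly)
  qed
  then have "[:1, - ([:0, 1:] ^ s):] dvd p"
    by (rule dvd_of_reflect_root) simp
  then show ?thesis
    by (simp add: var_a_def var_q_power one_pCons)
qed

text \<open>Division by the monic q^M - 1 stays within integer polynomials. The remainder has degree
  below M but vanishes at all M complex roots of unity, so it is 0.\<close>

lemma qint_dvd_int_poly:
  assumes "M > 0" and "\<And>\<zeta>::complex. \<zeta> ^ M = 1 \<Longrightarrow> \<zeta> \<noteq> 1 \<Longrightarrow> eval1 \<zeta> c = 0"
  shows "qint [:0, 1:] M dvd c"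
proof -
  define x :: "int poly" where "x = [:0, 1:]"
  define g where "g = x ^ M - 1"
  have g: "g = - ((1 - x) * qint x M)" unfolding g_def qint_mult by simp
  have gm: "g = monom 1 M - 1" by (simp add: g_def x_def monom_altdef)
  have cg: "coeff g M = 1" unfolding gm using \<open>M > 0\<close> by simp
  have dg: "degree g = M"
  proof (rule antisym)
    show "degree g \<le> M" unfolding gm by (intro degree_diff_le) (simp_all add: degree_monom_le)
    show "M \<le> degree g" using cg by (intro le_degree) simp
  qed
  have g0: "g \<noteq> 0" using cg by auto
  \<comment> \<open>The factor 1 - x supplies the missing zero at 1 and is cancelled at the
    end.\<close>
  define f where "f = (1 - x) * c"
  obtain h r where hr: "pseudo_divmod f g = (h, r)" by (cases "pseudo_divmod f g")
  \<comment> \<open>Leading coefficient 1 makes the scaling factor of the pseudo-division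
    trivial.\<close>
  have fhr: "f = g * h + r" using pseudo_divmod(1)[OF g0 hr] by (simp add: dg cg)
  have dr: "r = 0 \<or> degree r < M" using pseudo_divmod(2)[OF g0 hr] dg by simp
  have "r = 0"
  proof (rule ccontr)
    assume "r \<noteq> 0"
    define R :: "complex poly" where "R = map_poly of_int r"
    have "R \<noteq> 0" unfolding R_def using \<open>r \<noteq> 0\<close> by (subst map_poly_eq_0_iff) auto
    have "poly R \<zeta> = 0" if "\<zeta> ^ M = 1" for \<zeta>
    proof -
      have "eval1 \<zeta> f = 0"
        using assms(2)[OF that] by (cases "\<zeta> = 1") (simp_all add: f_def x_def eval1_simps eval1_var)
      moreover have "eval1 \<zeta> g = 0" using that by (simp add: g_def x_def eval1_simps eval1_var)
      ultimately have "eval1 \<zeta> r = 0" unfolding fhr by (simp add: eval1_simps)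
      then show ?thesis by (simp add: R_def eval1_def)
    qed
    then have "card {\<zeta>::complex. \<zeta> ^ M = 1} \<le> card {\<zeta>. poly R \<zeta> = 0}"
      using poly_roots_finite[OF \<open>R \<noteq> 0\<close>] by (intro card_mono) auto
    also have "\<dots> \<le> degree R" by (rule card_poly_roots_bound) fact
    also have "\<dots> \<le> degree r" unfolding R_def by (rule map_poly_degree_leq)
    finally show False using dr \<open>r \<noteq> 0\<close> card_roots_unity_eq[OF \<open>M > 0\<close>] by simp
  qed
  then have "(1 - x) * c = (1 - x) * (qint x M * - h)"
    using fhr unfolding f_def g by simp
  moreover have "1 - x \<noteq> 0" by (simp add: x_def one_pCons)
  ultimately have "c = qint x M * - h" by (metis mult_cancel_left)
  then show ?thesis unfolding x_def by (metis dvd_triv_left)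
qed

text \<open>[M] is free of a, so divisibility is tested on the coefficients of the powers of a. For
  a fixed root of unity they all vanish, because the resulting polynomial in a has infinitely many
  zeros.\<close>

lemma qint_dvd:
  assumes "M > 0" and "infinite A"
    and "\<And>\<zeta> \<alpha>. \<zeta> ^ M = 1 \<Longrightarrow> \<zeta> \<noteq> 1 \<Longrightarrow> \<alpha> \<in> A \<Longrightarrow> eval2 \<zeta> \<alpha> p = 0"
  shows "qint var_q M dvd p"
  unfolding qint_var_q const_poly_dvd_iff
proof (intro allI qint_dvd_int_poly[OF assms(1)])
  fix i \<zeta> assume \<zeta>: "\<zeta> ^ M = (1::complex)" "\<zeta> \<noteq> 1"
  have "map_poly (eval1 \<zeta>) p = 0"
  proof (rule ccontr)
    assume "map_poly (eval1 \<zeta>) p \<noteq> 0"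
    then have "finite {\<alpha>. poly (map_poly (eval1 \<zeta>) p) \<alpha> = 0}" by (rule poly_roots_finite)
    moreover have "A \<subseteq> {\<alpha>. poly (map_poly (eval1 \<zeta>) p) \<alpha> = 0}"
      using assms(3)[OF \<zeta>] by (auto simp: eval2_def)
    ultimately show False using assms(2) finite_subset by metis
  qed
  then have "coeff (map_poly (eval1 \<zeta>) p) i = 0" by simp
  then show "eval1 \<zeta> (coeff p i) = 0" by (simp add: coeff_map_poly eval1_simps)
qed

lemma prod_dvd_of_pairwise_coprime:
  fixes f :: "'b \<Rightarrow> 'a::semiring_gcd"
  assumes "finite I" and "\<And>i. i \<in> I \<Longrightarrow> f i dvd p"
    and "\<And>i j. i \<in> I \<Longrightarrow> j \<in> I \<Longrightarrow> i \<noteq> j \<Longrightarrow> coprime (f i) (f j)"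
  shows "prod f I dvd p"
  using assms
proof (induction I rule: finite_induct)
  case (insert i I)
  then have "coprime (f i) (prod f I)" by (intro prod_coprime_right) auto
  then show ?case using insert by (auto intro: divides_mult)
qed simp

lemma modulus_dvd:
  fixes n M J :: nat
  assumes "M > 0" and "n > 0" and "qint var_q M dvd p"
    and "\<And>j. j \<le> J \<Longrightarrow> 1 - var_a * var_q ^ ((2 * j + 1) * n) dvd p"
    and "\<And>j. j \<le> J \<Longrightarrow> var_a - var_q ^ ((2 * j + 1) * n) dvd p"
  shows "qint var_q M * (\<Prod>j=0..J. (1 - var_a * var_q ^ ((2 * j + 1) * n)) * (var_a - var_q ^ ((2 * j + 1) * n))) dvd p"
proof (rule divides_mult)
  have ne: "(2 * i + 1) * n \<noteq> (2 * j + 1) * n" if "i \<noteq> j" for i j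
    using that \<open>n > 0\<close> by simp
  have pos: "(2 * i + 1) * n + (2 * j + 1) * n > 0" for i j
    using \<open>n > 0\<close> by simp
  show "(\<Prod>j=0..J. (1 - var_a * var_q ^ ((2 * j + 1) * n)) * (var_a - var_q ^ ((2 * j + 1) * n))) dvd p"
  proof (rule prod_dvd_of_pairwise_coprime)
    fix j assume "j \<in> {0..J}"
    then show "(1 - var_a * var_q ^ ((2 * j + 1) * n)) * (var_a - var_q ^ ((2 * j + 1) * n)) dvd p"
      using assms(4)[of j] assms(5)[of j] pos[of j j] by (intro divides_mult coprime_one_minus_a_minus) auto
  next
    fix i j :: nat assume ij: "i \<noteq> j"
    let ?A = "\<lambda>j. 1 - var_a * var_q ^ ((2 * j + 1) * n)" and ?B = "\<lambda>j. var_a - var_q ^ ((2 * j + 1) * n)"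
    have "coprime (?A i) (?A j)" "coprime (?B i) (?B j)"
      using ne[OF ij] by (rule coprime_one_minus_one_minus, rule coprime_a_minus_a_minus)
    moreover have "coprime (?A i) (?B j)" by (rule coprime_one_minus_a_minus) (rule pos)
    moreover have "coprime (?B i) (?A j)" by (subst coprime_commute, rule coprime_one_minus_a_minus) (rule pos)
    ultimately show "coprime ((1 - var_a * var_q ^ ((2 * i + 1) * n)) * (var_a - var_q ^ ((2 * i + 1) * n)))
      ((1 - var_a * var_q ^ ((2 * j + 1) * n)) * (var_a - var_q ^ ((2 * j + 1) * n)))"
      unfolding coprime_mult_left_iff coprime_mult_right_iff
      by (intro conjI)
  qed simp
  show "coprime (qint var_q M) (\<Prod>j=0..J. (1 - var_a * var_q ^ ((2 * j + 1) * n)) * (var_a - var_q ^ ((2 * j + 1) * n)))"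
    unfolding qint_var_q using qint_var_nonzero[OF assms(1)]
    by (intro prod_coprime_right) (auto intro!: coprime_const_one_minus coprime_const_a_minus)
qed (fact assms(3))

text \<open>Parity separates denominators and modulus: the exponents (2 j + 1) n are odd, those in
  the denominators even. The claim for \<open>var_q\<close> serves the factor q^((1 - n) /
  2).\<close>

lemma coprime_modulus:
  fixes n M J :: nat
  assumes "odd M" and "odd n"
  defines "P \<equiv> qint var_q M * (\<Prod>j=0..J. (1 - var_a * var_q ^ ((2 * j + 1) * n)) * (var_a - var_q ^ ((2 * j + 1) * n)))"
  shows "coprime var_a P" and "coprime var_q P" and "\<And>i. i > 0 \<Longrightarrow> coprime (1 + var_q ^ i) P"
    and "\<And>i. coprime (1 - var_a * var_q ^ (2 * i)) P" and "\<And>i. coprime (var_a - var_q ^ (2 * i)) P"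
proof -
  have M: "M > 0" and n: "n > 0" using assms by (auto intro: odd_pos)
  have PI: "coprime D P" if "coprime D (qint var_q M)"
    "\<And>s. odd s \<Longrightarrow> coprime D (1 - var_a * var_q ^ s)" "\<And>s. odd s \<Longrightarrow> coprime D (var_a - var_q ^ s)" for D
  proof -
    have "odd ((2 * j + 1) * n)" for j using \<open>odd n\<close> by simp
    then show ?thesis unfolding P_def coprime_mult_right_iff using that
      by (intro conjI prod_coprime_right) (simp_all add: coprime_mult_right_iff)
  qed
  have Q: "qint var_q M = [:qint [:0, 1:] M:]" "qint [:0, 1::int:] M \<noteq> 0"
    using qint_var_q qint_var_nonzero[OF M] by auto
  show "coprime var_a P"
  proof (rule PI)
    show "coprime var_a (qint var_q M)" unfolding Q(1)
      by (rule bipoly_coprimeI[of 0 _ 1 _ "qint [:0, 1:] M" 1]) (use Q in \<open>auto simp: var_a_def\<close>)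
    show "coprime var_a (1 - var_a * var_q ^ s)" for s
      by (rule coprime_bezout_1[of "var_q ^ s" _ 1]) (simp add: algebra_simps)
    show "coprime var_a (var_a - var_q ^ s)" for s
      by (rule bipoly_coprimeI[of 1 _ "-1" _ "[:0, 1:] ^ s" 1]) (auto simp: var_q_power var_a_def)
  qed
  show "coprime var_q P"
  proof (rule PI)
    obtain m where "M = Suc m" using M by (cases M) auto
    then have "qint var_q M = 1 + var_q * (\<Sum>i<m. var_q ^ i)"
      by (simp only: qint_def sum.lessThan_Suc_shift sum_distrib_left power_Suc power_0)
    then show "coprime var_q (qint var_q M)"
      by (intro coprime_bezout_1[of "- (\<Sum>i<m. var_q ^ i)" _ 1]) (simp add: algebra_simps)
    show "coprime var_q (1 - var_a * var_q ^ s)" "coprime var_q (var_a - var_q ^ s)" for s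
      using coprime_const_one_minus[of "[:0, 1:]"] coprime_const_a_minus[of "[:0, 1:]"] by (auto simp: var_q_def)
  qed
  show "coprime (1 + var_q ^ i) P" if "i > 0" for i
  proof (rule PI)
    show "coprime (1 + var_q ^ i) (qint var_q M)" using \<open>odd M\<close> by (rule coprime_one_plus_power_qint)
    have e: "1 + var_q ^ i = [:1 + [:0, 1:] ^ i:]" by (simp add: var_q_power one_pCons)
    have ne: "1 + [:0, 1::int:] ^ i \<noteq> 0"
    proof
      assume "1 + [:0, 1::int:] ^ i = 0"
      then have "eval1 1 (1 + [:0, 1::int:] ^ i) = 0" by (simp add: eval1_simps)
      then show False by (simp add: eval1_simps eval1_var)
    qed
    show "coprime (1 + var_q ^ i) (1 - var_a * var_q ^ s)" "coprime (1 + var_q ^ i) (var_a - var_q ^ s)" for s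
      unfolding e by (rule coprime_const_one_minus[OF ne], rule coprime_const_a_minus[OF ne])
  qed
  show "coprime (1 - var_a * var_q ^ (2 * i)) P" for i
  proof (rule PI)
    show "coprime (1 - var_a * var_q ^ (2 * i)) (qint var_q M)"
      unfolding Q(1) by (subst coprime_commute) (rule coprime_const_one_minus[OF Q(2)])
    fix s :: nat assume "odd s"
    then have c: "2 * i \<noteq> s" "2 * i + s > 0" by (auto intro: odd_pos)
    show "coprime (1 - var_a * var_q ^ (2 * i)) (1 - var_a * var_q ^ s)"
      "coprime (1 - var_a * var_q ^ (2 * i)) (var_a - var_q ^ s)"
      by (rule coprime_one_minus_one_minus[OF c(1)], rule coprime_one_minus_a_minus[OF c(2)])
  qed
  show "coprime (var_a - var_q ^ (2 * i)) P" for i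
  proof (rule PI)
    show "coprime (var_a - var_q ^ (2 * i)) (qint var_q M)"
      unfolding Q(1) by (subst coprime_commute) (rule coprime_const_a_minus[OF Q(2)])
    fix s :: nat assume "odd s"
    then have c: "2 * i \<noteq> s" "s + 2 * i > 0" by (auto intro: odd_pos)
    show "coprime (var_a - var_q ^ (2 * i)) (var_a - var_q ^ s)"
      by (rule coprime_a_minus_a_minus[OF c(1)])
    show "coprime (var_a - var_q ^ (2 * i)) (1 - var_a * var_q ^ s)"
      by (subst coprime_commute) (rule coprime_one_minus_a_minus[OF c(2)])
  qed
qed

section \<open>Values of the difference of the two sides at complex points\<close>

text \<open>Generic in the field, so that the rational function and its complex values are instances
  of one expression.\<close>

definition side_difference :: "'a::field \<Rightarrow> 'a \<Rightarrow> nat \<Rightarrow> nat \<Rightarrow> nat \<Rightarrow> 'a" where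
  "side_difference a q n K K' = (\<Sum>k\<le>K. reg_term a q k) -
     inverse (q ^ ((n - 1) div 2)) * qint q n * (\<Sum>k\<le>K'. reg_term a (q ^ n) k)"

text \<open>Excludes every zero of a denominator for all k at once, which makes the condition stable
  under z -> z^n and so covers the right sum as well.\<close>

definition regular_point :: "complex \<Rightarrow> complex \<Rightarrow> bool" where
  "regular_point z \<alpha> \<longleftrightarrow> z \<noteq> 0 \<and> \<alpha> \<noteq> 0 \<and> (\<forall>i. z ^ i \<noteq> - 1) \<and> (\<forall>i. \<alpha> * z ^ (2 * i) \<noteq> 1) \<and> (\<forall>i. z ^ (2 * i) \<noteq> \<alpha>)"

lemma regular_point_power: "regular_point z \<alpha> \<Longrightarrow> regular_point (z ^ n) \<alpha>"
  unfolding regular_point_def power_mult[symmetric] by (simp add: mult.left_commute[of n 2])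

lemma has_val_side_difference:
  assumes "regular_point z \<alpha>"
  shows "has_val z \<alpha> (side_difference qa qq n K K') (side_difference \<alpha> z n K K')"
proof -
  have "has_val z \<alpha> (reg_term qa (qq ^ s) k) (reg_term \<alpha> (z ^ s) k)" for s k
    using regular_point_power[OF assms, of s] unfolding regular_point_def
    by (intro has_val_reg_term has_val_var has_val_power) auto
  from this[of 1] this[of n] show ?thesis
    unfolding side_difference_def using assms
    by (intro has_val_diff has_val_sum has_val_mult has_val_inverse has_val_qint has_val_power has_val_var)
      (auto simp: regular_point_def)
qed

text \<open>By this symmetry the points a = q^(-N) need no summation formula of their own.\<close>

lemma reg_term_inverse: "reg_term (inverse a) q k = reg_term a q k"
  by (simp add: reg_term_def divide_inverse mult_ac)

lemma side_difference_inverse: "side_difference (inverse a) q n K K' = side_difference a q n K K'"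
  by (simp add: side_difference_def reg_term_inverse)

lemma side_difference_terminating:
  fixes z :: complex
  assumes "z \<noteq> 0" and q1: "\<And>i. 0 < i \<Longrightarrow> z ^ i \<noteq> 1" and "odd n"
    and "j \<le> K'" and "((2 * j + 1) * n - 1) div 2 \<le> K"
  shows "side_difference (z ^ ((2 * j + 1) * n)) z n K K' = 0"
proof -
  obtain h where h: "n = 2 * h + 1" using \<open>odd n\<close> by (elim oddE)
  have zn: "(z ^ n) ^ i \<noteq> 1" if "0 < i" for i
    using q1[of "n * i"] that h by (simp only: power_mult[symmetric]) simp
  have reg: "reg_term a z k = vwp_term a z k" "reg_term a (z ^ n) k = vwp_term a (z ^ n) k" for a k
    by (rule reg_term_eq; simp add: q1 zn)+
  \<comment> \<open>This m equals n j + h. The right sum, in base q^n with a = (q^n)^(2 j + 1),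
    brings q^(-n j); the missing q^(-h) is the prefactor q^((1 - n) / 2).\<close>
  define m where "m = (2 * j + 1) * h + j"
  have N: "(2 * j + 1) * n = 2 * m + 1" unfolding m_def h by (simp add: algebra_simps)
  have "m \<le> K" using assms(5) unfolding N by simp
  have "(\<Sum>k\<le>K. reg_term (z ^ ((2 * j + 1) * n)) z k) = (1 - z ^ ((2 * j + 1) * n)) / (1 - z) / z ^ m"
    unfolding N reg using assms(1) q1 \<open>m \<le> K\<close> by (rule vwp_sum_terminating)
  moreover have "(\<Sum>k\<le>K'. reg_term (z ^ ((2 * j + 1) * n)) (z ^ n) k)
      = (1 - z ^ ((2 * j + 1) * n)) / (1 - z ^ n) / (z ^ n) ^ j"
  proof -
    have e: "z ^ ((2 * j + 1) * n) = (z ^ n) ^ (2 * j + 1)" by (simp only: power_mult[symmetric] mult.commute)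
    show ?thesis unfolding e reg using assms(1) by (intro vwp_sum_terminating zn \<open>j \<le> K'\<close>) auto
  qed
  moreover have "qint z n = (1 - z ^ n) / (1 - z)" using q1[of 1] by (intro qint_eq) auto
  moreover have "z ^ m = (z ^ n) ^ j * z ^ h"
    unfolding power_mult[symmetric] power_add[symmetric] m_def h by (simp add: algebra_simps)
  moreover have "(n - 1) div 2 = h" using h by simp
  \<comment> \<open>The comparison of both values with t = 1 - z^N for N = (2 j + 1) n, c = 1 - z, w
    = 1 - z^n, u = z^(n j) and v = z^h.\<close>
  moreover have "t / c / (u * v) - inverse v * (w / c) * (t / w / u) = 0" if "w \<noteq> 0" for t c u v w :: complex
    using that by (cases "c = 0"; cases "u = 0"; cases "v = 0") (simp_all add: field_simps)
  moreover have "1 - z ^ n \<noteq> 0" using zn[of 1] by simp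
  ultimately show ?thesis
    unfolding side_difference_def by (simp only: not_False_eq_True)
qed

lemma side_difference_root_of_unity:
  fixes \<zeta> \<alpha> :: complex
  assumes "regular_point \<zeta> \<alpha>" and "\<And>i. \<alpha> * \<zeta> ^ i \<noteq> 1" and "\<And>i. \<zeta> ^ i \<noteq> \<alpha>"
    and "\<zeta> ^ (n ^ r) = 1" and "\<zeta> \<noteq> 1" and "odd n" and "r \<ge> 1" and "d \<in> {1, 2}"
  shows "side_difference \<alpha> \<zeta> n ((n ^ r - 1) div d) ((n ^ (r - 1) - 1) div d) = 0"
proof -
  have \<alpha>: "\<alpha> \<noteq> 0" using assms(1) by (simp add: regular_point_def)
  have "(\<Sum>k\<le>(n ^ r - 1) div d. reg_term \<alpha> \<zeta> k) = 0"
    using \<alpha> assms by (intro reg_sum_root_of_unity) auto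
  \<comment> \<open>The power \<zeta>^n is an n^(r - 1)-th root of unity: if it is 1, then [n]
    vanishes, otherwise the sum in base \<zeta>^n does. For r = 1 only the first case
    occurs.\<close>
  moreover have "qint \<zeta> n = 0 \<or> (\<Sum>k\<le>(n ^ (r - 1) - 1) div d. reg_term \<alpha> (\<zeta> ^ n) k) = 0"
  proof (cases "\<zeta> ^ n = 1")
    case True
    then show ?thesis using \<open>\<zeta> \<noteq> 1\<close> by (simp add: qint_eq)
  next
    case False
    have "(\<zeta> ^ n) ^ (n ^ (r - 1)) = 1"
      using assms(4) \<open>r \<ge> 1\<close> by (cases r) (simp_all add: power_mult)
    then show ?thesis
      using \<alpha> assms False by (intro disjI2 reg_sum_root_of_unity) (auto simp flip: power_mult)
  qed
  ultimately show ?thesis unfolding side_difference_def by auto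
qed

lemma norm_power_eq_1:
  fixes z :: complex
  assumes "norm z > 1" and "norm (z ^ i) = 1"
  shows "i = 0"
  using assms one_less_power[of "norm z" i] by (cases "i = 0") (auto simp: norm_power)

theorem theorem2p3:
  fixes n r d :: nat
  assumes "odd n" and "n > 1" and "r \<ge> 1" and "d \<in> {1, 2}"
  shows "cong_rf
    (\<Sum>k=0..(n ^ r - 1) div d.
       qint qq (4 * k + 1) *
       (qpoch (qa * qq) (qq ^ 2) k * qpoch (qq / qa) (qq ^ 2) k * (qpoch qq (qq ^ 2) k) ^ 2) /
       (qpoch (qa * qq ^ 2) (qq ^ 2) k * qpoch (qq ^ 2 / qa) (qq ^ 2) k * (qpoch (qq ^ 2) (qq ^ 2) k) ^ 2))
    (qq powi ((1 - int n) div 2) * qint qq n *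
     (\<Sum>k=0..(n ^ (r - 1) - 1) div d.
       qint (qq ^ n) (4 * k + 1) *
       (qpoch (qa * qq ^ n) (qq ^ (2 * n)) k * qpoch (qq ^ n / qa) (qq ^ (2 * n)) k *
          (qpoch (qq ^ n) (qq ^ (2 * n)) k) ^ 2) /
       (qpoch (qa * qq ^ (2 * n)) (qq ^ (2 * n)) k * qpoch (qq ^ (2 * n) / qa) (qq ^ (2 * n)) k *
          (qpoch (qq ^ (2 * n)) (qq ^ (2 * n)) k) ^ 2)))
    (qint var_q (n ^ r) *
     (\<Prod>j=0..(n ^ (r - 1) - 1) div d.
        (1 - var_a * var_q ^ ((2 * j + 1) * n)) * (var_a - var_q ^ ((2 * j + 1) * n))))"
  (is "cong_rf ?L ?R ?P")
proof -
  define K K' where "K = (n ^ r - 1) div d" and "K' = (n ^ (r - 1) - 1) div d"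
  define \<Delta> where "\<Delta> = side_difference qa qq n K K'"
  have odd: "odd (n ^ r)" using \<open>odd n\<close> by simp
  then have M: "n ^ r > 0" by (rule odd_pos)
  have nr: "n ^ r = n ^ (r - 1) * n" using \<open>r \<ge> 1\<close> by (cases r) simp_all
  have qq1: "qq ^ i \<noteq> 1" if "0 < i" for i
  proof
    assume "qq ^ i = 1"
    then have "var_q ^ i = 1" unfolding qq_def to_fract_power[symmetric] by (metis to_fract_1 to_fract_eq_iff)
    then have "eval2 0 0 (var_q ^ i) = 1" by (simp add: eval2_simps)
    then show False using that by (simp add: eval2_simps eval2_var power_0_left)
  qed
  have diff: "?L - ?R = \<Delta>"
  proof -
    have "?L = (\<Sum>k\<le>K. reg_term qa qq k)"
      unfolding K_def atMost_atLeast0 using qq1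
      by (intro sum.cong refl) (subst reg_term_eq, simp_all add: vwp_term_def)
    moreover have "(\<Sum>k\<le>K'. reg_term qa (qq ^ n) k) = (\<Sum>k=0..K'. vwp_term qa (qq ^ n) k)"
      unfolding atMost_atLeast0 using qq1 \<open>n > 1\<close>
      by (intro sum.cong refl reg_term_eq) (simp flip: power_mult)
    moreover have "qq powi ((1 - int n) div 2) = inverse (qq ^ ((n - 1) div 2))"
    proof -
      obtain h where "n = 2 * h + 1" using \<open>odd n\<close> by (elim oddE)
      \<comment> \<open>As n is odd, the integer division is exact.\<close>
      moreover from this have "(1 - int n) div 2 = - int h" by presburger
      ultimately show ?thesis by (simp add: power_int_minus)
    qed
    moreover have "(qq ^ n) ^ 2 = qq ^ (2 * n)" by (simp flip: power_mult add: mult.commute)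
    ultimately show ?thesis
      by (simp add: \<Delta>_def side_difference_def vwp_term_def K_def K'_def)
  qed
  have "localized ?P (reg_term qa (qq ^ s) k)" if "s > 0" for s k
    using coprime_modulus[OF odd \<open>odd n\<close>] that by (intro localized_reg_term)
  from this[of 1] this[of n] have "localized ?P \<Delta>"
    unfolding \<Delta>_def side_difference_def power_inverse[symmetric] using coprime_modulus(2)[OF odd \<open>odd n\<close>] \<open>n > 1\<close>
    by (intro localized_diff localized_sum localized_mult localized_power localized_qint)
      (auto simp: qq_def localized_to_fract var_q_def intro!: localized_inverse)
  then obtain N D where ND: "D \<noteq> 0" "coprime D ?P" "\<Delta> = to_fract N / to_fract D"
    unfolding localized_def by blast
  \<comment> \<open>\<open>D\<close> is prime to the modulus but may still vanish at single points,
    so the zero of \<open>N\<close> is obtained from a second representation that is regular at the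
    point.\<close>
  have vanish: "eval2 z \<alpha> N = 0" if "regular_point z \<alpha>" "side_difference \<alpha> z n K K' = 0" for z \<alpha>
    using has_val_side_difference[OF that(1), of n K K'] that(2) ND(1)
    unfolding \<Delta>_def[symmetric] ND(3) by (auto intro: has_val_0_numerator)
  define Z :: "complex set" where "Z = of_nat ` {2..}"
  have Z: "infinite Z" "0 \<notin> Z" "\<And>z. z \<in> Z \<Longrightarrow> norm z > 1"
    unfolding Z_def by (auto simp: infinite_Ici finite_image_iff)
  have Z1: "0 < i \<Longrightarrow> z ^ i \<noteq> 1" "z ^ i \<noteq> - 1" "z \<noteq> 0" if "z \<in> Z" for z i
    using norm_power_eq_1[OF Z(3)[OF that], of i] Z(2) that by auto
  have regular_odd: "regular_point z (z ^ s)" "regular_point z (inverse (z ^ s))" if "z \<in> Z" "odd s" for z s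
  proof -
    have inj: "s \<noteq> 2 * i" for i using \<open>odd s\<close> by auto
    have "z ^ s * z ^ (2 * i) \<noteq> 1" "z ^ (2 * i) \<noteq> z ^ s" for i
      using Z1(1)[OF that(1), of "s + 2 * i"] \<open>odd s\<close> power_inj_nonroot[OF Z1(3,1)[OF that(1)], of "2 * i" s] inj
      by (auto simp: power_add odd_pos)
    then show "regular_point z (z ^ s)" "regular_point z (inverse (z ^ s))"
      using Z1[OF that(1)] by (auto simp: regular_point_def field_simps)
  qed
  have zeros: "side_difference (z ^ ((2 * j + 1) * n)) z n K K' = 0" if "z \<in> Z" "j \<le> K'" for z j
  proof (rule side_difference_terminating)
    \<comment> \<open>The left sum has to reach its last nonzero term. For d = 1 one has (2 j + 1) n
      at most 2 n^r - n; for d = 2 it is at most n^r, with equality for the last j.\<close>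
    show "((2 * j + 1) * n - 1) div 2 \<le> K"
    proof (cases "d = 1")
      case True
      have "n ^ (r - 1) > 0" using \<open>n > 1\<close> by simp
      moreover have "j \<le> n ^ (r - 1) - 1" using \<open>j \<le> K'\<close> True unfolding K'_def by simp
      ultimately have "2 * j + 2 \<le> 2 * n ^ (r - 1)" by linarith
      then have "(2 * j + 2) * n \<le> 2 * n ^ (r - 1) * n" by (rule mult_le_mono1)
      then have "(2 * j + 1) * n + n \<le> 2 * n ^ r" unfolding nr by (simp add: algebra_simps)
      then show ?thesis unfolding K_def True using \<open>n > 1\<close> by simp
    next
      case False
      then have d: "d = 2" using \<open>d \<in> {1, 2}\<close> by auto
      have "odd (n ^ (r - 1))" using \<open>odd n\<close> by simp
      moreover have "j \<le> (n ^ (r - 1) - 1) div 2" using \<open>j \<le> K'\<close> unfolding K'_def d .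
      ultimately have "2 * j + 1 \<le> n ^ (r - 1)" by presburger
      then have "(2 * j + 1) * n \<le> n ^ (r - 1) * n" by (rule mult_le_mono1)
      then show ?thesis unfolding K_def d nr by (intro div_le_mono diff_le_mono)
    qed
  qed (use Z1[OF that(1)] that \<open>odd n\<close> in auto)
  have "?P dvd N"
  proof (rule modulus_dvd[OF M])
    show "qint var_q (n ^ r) dvd N"
    proof (rule qint_dvd[OF M Z(1)])
      fix \<zeta> \<alpha> assume \<zeta>: "\<zeta> ^ (n ^ r) = (1::complex)" "\<zeta> \<noteq> 1" and \<alpha>: "\<alpha> \<in> Z"
      have "norm \<zeta> = 1"
      proof (rule power_eq_imp_eq_base)
        show "norm \<zeta> ^ (n ^ r) = 1 ^ (n ^ r)" unfolding norm_power[symmetric] \<zeta>(1) by simp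
      qed (use M in auto)
      then have ni: "norm (\<zeta> ^ i) = 1" for i by (simp add: norm_power)
      have n1: "\<alpha> * \<zeta> ^ i \<noteq> 1" "\<zeta> ^ i \<noteq> \<alpha>" for i
      proof -
        show "\<alpha> * \<zeta> ^ i \<noteq> 1" using Z(3)[OF \<alpha>] ni[of i] by (metis less_irrefl mult.right_neutral norm_mult norm_one)
        show "\<zeta> ^ i \<noteq> \<alpha>" using Z(3)[OF \<alpha>] ni[of i] by auto
      qed
      \<comment> \<open>Raising to the odd power n^r would give 1 = -1.\<close>
      have m1: "\<zeta> ^ i \<noteq> - 1" for i
      proof
        assume "\<zeta> ^ i = - 1"
        then have "(\<zeta> ^ (n ^ r)) ^ i = (- 1) ^ (n ^ r)" by (metis mult.commute power_mult)
        then show False using \<zeta>(1) odd by simp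
      qed
      have g: "regular_point \<zeta> \<alpha>"
        using n1 m1 ni[of 1] Z1(3)[OF \<alpha>] by (auto simp: regular_point_def)
      then show "eval2 \<zeta> \<alpha> N = 0"
      proof (rule vanish)
        show "side_difference \<alpha> \<zeta> n K K' = 0"
          unfolding K_def K'_def using g n1 \<zeta> assms(1,3,4) by (rule side_difference_root_of_unity)
      qed
    qed
    fix j assume "j \<le> (n ^ (r - 1) - 1) div d"
    then have j: "j \<le> K'" by (simp only: K'_def)
    show "1 - var_a * var_q ^ ((2 * j + 1) * n) dvd N"
      using regular_odd zeros[OF _ j] \<open>odd n\<close>
      by (intro one_minus_a_power_dvd[OF Z(1,2)] vanish) (auto simp: side_difference_inverse)
    show "var_a - var_q ^ ((2 * j + 1) * n) dvd N"
      using regular_odd zeros[OF _ j] \<open>odd n\<close> by (intro a_minus_power_dvd[OF Z(1)] vanish) auto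
  qed (use \<open>n > 1\<close> in simp)
  then show ?thesis
    unfolding cong_rf_def diff using ND by blast
qed

end
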